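(* Let $n,k,t$ be integers with $k\geq 2$, $1\leq t\leq 2k-2$ and $n\geq 252t^2k$. If $G$ is a $C_{2k+1}$-free graph on $n$ vertices with $$\gamma_2(G)\geq \binom{\lfloor\frac{t+2}{2}\rfloor}{2}+\binom{\lceil\frac{t+2}{2}\rceil}{2},$$ then $$e(G)\leq \left\lfloor\frac{(n-t-1)^2}{4}\right\rfloor+\binom{t+2}{2},$$ with equality if and only if $G$ is isomorphic to $H(n,t)$.
   Context: All graphs are finite and simple. $e(G)$ denotes the number of edges of $G$. $G$ is $C_{2k+1}$-free if it contains no cycle of length $2k+1$ as a subgraph. $\gamma_2(G)=\min\{|E|: E\subseteq E(G),\ G-E \text{ is bipartite}\}$, where $G-E$ is obtained from $G$ by deleting the edges in $E$. $T_2(m)$ denotes the complete bipartite graph on $m$ vertices with parts of sizes $\lfloor m/2\rfloor$ and $\lceil m/2\rceil$. $H(n,t)$ is the graph obtained from disjoint copies of $T_2(n-t-1)$ and $K_{t+2}$ by identifying one vertex of the first with one vertex of the second (so it has $n$ vertices). *)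

theory Defs
  imports Main
begin

datatype 'a graph = Graph (verts: "'a set") (edges: "'a set set")

definition simple_graph :: "'a graph \<Rightarrow> bool" where
  "simple_graph G \<longleftrightarrow>
     finite (verts G) \<and> (\<forall>e\<in>edges G. e \<subseteq> verts G \<and> card e = 2)"

definition graph_iso :: "'a graph \<Rightarrow> 'b graph \<Rightarrow> bool" where
  "graph_iso G H \<longleftrightarrow>
     (\<exists>f. bij_betw f (verts G) (verts H) \<and> edges H = (\<lambda>e. f ` e) ` edges G)"

text \<open>A cycle is the list of its vertices in cyclic order; its length is the length of the list.\<close>

definition is_cycle :: "'a graph \<Rightarrow> 'a list \<Rightarrow> bool" where
  "is_cycle G p \<longleftrightarrow>
     3 \<le> length p \<and> distinct p \<and> set p \<subseteq> verts G \<and>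
     (\<forall>i<length p. {p ! i, p ! (Suc i mod length p)} \<in> edges G)"

definition cycle_free :: "nat \<Rightarrow> 'a graph \<Rightarrow> bool" where
  "cycle_free m G \<longleftrightarrow> \<not> (\<exists>p. is_cycle G p \<and> length p = m)"

definition bipartite :: "'a graph \<Rightarrow> bool" where
  "bipartite G \<longleftrightarrow>
     (\<exists>A B. A \<union> B = verts G \<and> A \<inter> B = {} \<and>
            (\<forall>e\<in>edges G. \<exists>a\<in>A. \<exists>b\<in>B. e = {a, b}))"

definition delete_edges :: "'a graph \<Rightarrow> 'a set set \<Rightarrow> 'a graph" where
  "delete_edges G D = Graph (verts G) (edges G - D)"

definition gamma2 :: "'a graph \<Rightarrow> nat" where
  "gamma2 G = Min {card D | D. D \<subseteq> edges G \<and> bipartite (delete_edges G D)}"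

definition complete_graph :: "nat \<Rightarrow> nat graph" where
  "complete_graph m = Graph {..<m} {{i, j} | i j. i < j \<and> j < m}"

text \<open>The parts of \<open>turan2 m\<close> are \<open>{..<m div 2}\<close> and \<open>{m div 2..<m}\<close>.\<close>

definition turan2 :: "nat \<Rightarrow> nat graph" where
  "turan2 m = Graph {..<m} {{i, j} | i j. i < m div 2 \<and> m div 2 \<le> j \<and> j < m}"

text \<open>Disjoint union of two graphs with the vertex \<open>w\<close> of the second identified with the
  vertex \<open>u\<close> of the first; the merged vertex is represented by \<open>Inl u\<close>.\<close>

definition identify_vertices ::
    "'a graph \<Rightarrow> 'a \<Rightarrow> 'b graph \<Rightarrow> 'b \<Rightarrow> ('a + 'b) graph" where
  "identify_vertices G u H w =
     (let g = (\<lambda>x. if x = w then Inl u else Inr x) in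
      Graph (Inl ` verts G \<union> g ` verts H)
            ((\<lambda>e. Inl ` e) ` edges G \<union> (\<lambda>e. g ` e) ` edges H))"

text \<open>If \<open>n - t - 1\<close> is odd, the result of the identification depends, up to isomorphism, on
  the part of \<open>turan2 (n - t - 1)\<close> in which the identified vertex lies. Hence \<open>H(n,t)\<close> is
  the set of all graphs obtained by the construction; they all have the same number of edges.\<close>

definition H_graphs :: "nat \<Rightarrow> nat \<Rightarrow> (nat + nat) graph set" where
  "H_graphs n t =
     {identify_vertices (turan2 (n - t - 1)) u (complete_graph (t + 2)) w | u w.
        u \<in> verts (turan2 (n - t - 1)) \<and> w \<in> verts (complete_graph (t + 2))}"

end

theory Submission
  imports Defs
begin

text \<open>
  Take a vertex of maximum degree and its neighbourhood \<open>B\<close>. Since \<open>B\<close> spans no path on \<open>2 * k\<close>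
  vertices, it spans few edges, and Furedi's degree count shows that almost all pairs between
  \<open>B\<close> and its complement are edges. Hence there is a large bipartite core \<open>C\<close> in which any two
  vertices are joined by paths of all lengths in \<open>{2..2 * k}\<close> of the right parity, and every vertex
  outside \<open>C\<close> has degree at most \<open>5 * n / 12\<close>. An odd ear is a path that leaves \<open>C\<close> and returns to a
  different vertex with the wrong parity. It would close up to a cycle of length \<open>2 * k + 1\<close>
  unless it has length at least \<open>2 * k\<close>, so it has at least \<open>2 * k - 1\<close> interior vertices;
  in a shortest one these have so few neighbours that the graph would have fewer edges than
  \<open>H(n, 2 * k - 2)\<close>, and so fewer than \<open>H(n, t)\<close>.

  Without odd ears, enlarge \<open>C\<close> to a maximal set \<open>D\<close> with this property. Each of the \<open>m\<close>
  vertices outside \<open>D\<close> has at most one neighbour in \<open>D\<close>, so greedy colouring leaves at most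
  \<open>m\<^sup>2 div 4\<close> monochromatic edges. The bound on \<open>gamma2\<close> forces \<open>m \<ge> t + 1\<close>, and
  \<open>e(G) \<le> (n - m)\<^sup>2 div 4 + (m + 1 choose 2)\<close> is strictly decreasing in \<open>m\<close>.
\<close>

text \<open>The obstacle is that an ear with \<open>2 * k - 1\<close> interior vertices is as large
  as the clique of \<open>H(n, 2 * k - 2)\<close> without its cut vertex. Both leave
  \<open>n - (2 * k - 1)\<close> vertices for the bipartite part, so the leading terms agree and the
  contradiction must come from constant terms. Hence the exact control of the degrees and chords of
  a shortest ear, which rests on two principles: no rerouting may give a shorter odd ear, and none
  may close a cycle of length \<open>2 * k + 1\<close>. Vertices outside core and ear are harmless:
  a vertex of a balanced bipartite graph adds about \<open>n / 2\<close> edges, and they add at most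
  \<open>5 * n / 12\<close>. The constant 252 serves the core. Since
  \<open>t + k - 1 <= t * t * k\<close>, the error terms of order \<open>t * n\<close> and
  \<open>k * n\<close> add up to small multiples of \<open>n * n\<close>, and the fractions 1/120,
  1/7, 1/8 and 5/12 used below are compatible with that. The bound on \<open>gamma2\<close> equals
  \<open>(t + 1) * (t + 1) div 4\<close>, which is exactly what greedy colouring of
  \<open>t + 1\<close> outside vertices can leave.\<close>

locale fgraph =
  fixes V :: "'a set" and adj :: "'a \<Rightarrow> 'a \<Rightarrow> bool"
  assumes finite_V: "finite V"
    and adj_sym: "adj x y \<Longrightarrow> adj y x"
    and adj_irrefl: "\<not> adj x x"
    and adj_V: "adj x y \<Longrightarrow> x \<in> V"
begin

lemma adj_V2: "adj x y \<Longrightarrow> y \<in> V"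
  using adj_V adj_sym by blast

lemma adj_commute: "adj x y \<longleftrightarrow> adj y x"
  using adj_sym by blast

section \<open>Neighbourhoods and degree sums\<close>

definition nb :: "'a set \<Rightarrow> 'a \<Rightarrow> 'a set" where
  "nb S x = {y \<in> S. adj x y}"

text \<open>This counts ordered adjacent pairs, so \<open>dn S S\<close> is twice the number of
  edges inside \<open>S\<close>. All edge counts below are therefore doubled.\<close>

definition dn :: "'a set \<Rightarrow> 'a set \<Rightarrow> nat" where
  "dn X Y = (\<Sum>x\<in>X. card (nb Y x))"

lemma finite_nb [simp]: "finite (nb S x)"
  by (rule finite_subset[OF _ finite_V]) (auto simp: nb_def adj_V2)

lemma nb_Un: "nb (S \<union> T) x = nb S x \<union> nb T x"
  by (auto simp: nb_def)

lemma nb_mono: "S \<subseteq> T \<Longrightarrow> nb S x \<subseteq> nb T x"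
  by (auto simp: nb_def)

lemma nb_subset: "nb S x \<subseteq> S"
  by (auto simp: nb_def)

lemma card_nb_Un: "S \<inter> T = {} \<Longrightarrow> card (nb (S \<union> T) x) = card (nb S x) + card (nb T x)"
  unfolding nb_Un by (rule card_Un_disjoint[OF finite_nb finite_nb]) (auto simp: nb_def)

lemma card_nb_le: "finite S \<Longrightarrow> card (nb S x) \<le> card S"
  by (intro card_mono nb_subset)

lemma card_nb_mono: "S \<subseteq> T \<Longrightarrow> card (nb S x) \<le> card (nb T x)"
  by (intro card_mono nb_mono finite_nb)

lemma dn_Un_left: "finite X \<Longrightarrow> finite X' \<Longrightarrow> X \<inter> X' = {} \<Longrightarrow> dn (X \<union> X') Y = dn X Y + dn X' Y"
  unfolding dn_def by (rule sum.union_disjoint)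

lemma dn_Un_right: "Y \<inter> Y' = {} \<Longrightarrow> dn X (Y \<union> Y') = dn X Y + dn X Y'"
  unfolding dn_def by (simp add: card_nb_Un sum.distrib)

lemma dn_eq_card: "finite X \<Longrightarrow> dn X Y = card {(x, y). x \<in> X \<and> y \<in> Y \<and> adj x y}"
proof -
  assume "finite X"
  have "dn X Y = card (SIGMA x:X. nb Y x)"
    unfolding dn_def by (rule card_SigmaI[symmetric]) (use \<open>finite X\<close> in auto)
  also have "(SIGMA x:X. nb Y x) = {(x, y). x \<in> X \<and> y \<in> Y \<and> adj x y}"
    by (auto simp: nb_def)
  finally show ?thesis .
qed

lemma dn_commute:
  assumes "finite X" "finite Y"
  shows "dn X Y = dn Y X"
proof -
  have "{(x, y). x \<in> X \<and> y \<in> Y \<and> adj x y} = prod.swap ` {(x, y). x \<in> Y \<and> y \<in> X \<and> adj x y}"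
    by (force simp: adj_commute)
  then show ?thesis
    by (simp add: dn_eq_card assms card_image)
qed

lemma dn_le: "finite Y \<Longrightarrow> dn X Y \<le> card X * card Y"
  unfolding dn_def using sum_bounded_above[of X "\<lambda>x. card (nb Y x)" "card Y"] card_nb_le by simp

lemma dn_self_le:
  assumes "finite S"
  shows "dn S S \<le> card S * (card S - 1)"
proof -
  have "card (nb S x) \<le> card S - 1" if "x \<in> S" for x
  proof -
    have "nb S x \<subseteq> S - {x}" using adj_irrefl by (auto simp: nb_def)
    then have "card (nb S x) \<le> card (S - {x})" using assms by (intro card_mono) auto
    then show ?thesis using that assms by simp
  qed
  then show ?thesis unfolding dn_def using sum_bounded_above[of S "\<lambda>x. card (nb S x)" "card S - 1"] by simp
qed

lemma dn_Un_self:
  assumes "finite X" "finite Y" "X \<inter> Y = {}"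
  shows "dn (X \<union> Y) (X \<union> Y) = dn X X + 2 * dn X Y + dn Y Y"
  using assms by (simp add: dn_Un_left dn_Un_right dn_commute[of Y X])

lemma dn_insert_self:
  assumes "finite S" "v \<notin> S"
  shows "dn (insert v S) (insert v S) = dn S S + 2 * card (nb S v)"
proof -
  have "nb {v} v = {}" using adj_irrefl by (auto simp: nb_def)
  then have "dn {v} {v} = 0" by (simp add: dn_def)
  moreover have "dn S {v} = card (nb S v)"
    using dn_commute[of S "{v}"] assms by (simp add: dn_def)
  ultimately show ?thesis using dn_Un_self[of S "{v}"] assms by simp
qed

text \<open>\<open>length p\<close> counts vertices, so it is one more than the length of the path.\<close>

definition path :: "'a list \<Rightarrow> bool" where
  "path p \<longleftrightarrow> distinct p \<and> set p \<subseteq> V \<and> successively adj p"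

lemma path_rev: "path p \<Longrightarrow> path (rev p)"
  unfolding path_def by (auto simp: adj_commute)

lemma path_Cons: "path (x # p) \<longleftrightarrow> x \<in> V \<and> x \<notin> set p \<and> path p \<and> (p = [] \<or> adj x (hd p))"
  unfolding path_def by (cases p) auto

lemma path_append:
  "path (p @ q) \<longleftrightarrow> path p \<and> path q \<and> set p \<inter> set q = {} \<and> (p = [] \<or> q = [] \<or> adj (last p) (hd q))"
  unfolding path_def by (auto simp: successively_append_iff)

lemma path_take: "path p \<Longrightarrow> path (take i p)"
  using path_append[of "take i p" "drop i p"] by simp

lemma path_drop: "path p \<Longrightarrow> path (drop i p)"
  using path_append[of "take i p" "drop i p"] by simp

section \<open>Long paths and linking paths\<close>

definition avoids_cycle :: "nat \<Rightarrow> bool" where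
  "avoids_cycle m \<longleftrightarrow> \<not> (\<exists>p. path p \<and> length p = m \<and> adj (last p) (hd p))"

text \<open>The path grows at its head: the head has at least \<open>d\<close> neighbours in
  \<open>S\<close>, and fewer than \<open>d\<close> other vertices lie on the path so far.\<close>

lemma exists_long_path:
  assumes "S \<subseteq> V" "S \<noteq> {}" "\<And>v. v \<in> S \<Longrightarrow> d \<le> card (nb S v)" "j \<le> d"
  shows "\<exists>p. path p \<and> set p \<subseteq> S \<and> length p = Suc j"
  using assms(4)
proof (induction j)
  case 0
  obtain v where "v \<in> S" using assms(2) by blast
  then show ?case using assms(1) by (intro exI[of _ "[v]"]) (auto simp: path_def)
next
  case (Suc j)
  then obtain p where p: "path p" "set p \<subseteq> S" "length p = Suc j" by auto
  then have ne: "p \<noteq> []" by auto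
  let ?v = "hd p"
  have "?v \<in> S" using p ne by auto
  have "\<not> nb S ?v \<subseteq> set (tl p)"
  proof
    assume "nb S ?v \<subseteq> set (tl p)"
    then have "card (nb S ?v) \<le> card (set (tl p))" by (intro card_mono) auto
    also have "\<dots> \<le> j" using p card_length[of "tl p"] by simp
    finally show False using assms(3)[OF \<open>?v \<in> S\<close>] Suc.prems by simp
  qed
  then obtain w where w: "w \<in> S" "adj ?v w" "w \<notin> set (tl p)" by (auto simp: nb_def)
  then have "w \<notin> set p" using adj_irrefl ne by (cases p) auto
  then have "path (w # p)" using p w by (auto simp: path_Cons adj_commute adj_V2)
  then show ?case using p w by (intro exI[of _ "w # p"]) auto
qed

text \<open>A weak form of the Erdos--Gallai theorem on paths, which loses a factor of two.\<close>

lemma dn_le_if_no_path: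
  assumes "S \<subseteq> V" "\<And>p. path p \<Longrightarrow> set p \<subseteq> S \<Longrightarrow> length p \<noteq> Suc d" "1 \<le> d"
  shows "dn S S \<le> 2 * (d - 1) * card S"
  using finite_subset[OF assms(1) finite_V] assms
proof (induction S rule: finite_psubset_induct)
  case (psubset S)
  show ?case
  proof (cases "S = {}")
    case True
    then show ?thesis by (simp add: dn_def)
  next
    case False
    \<comment> \<open>If all degrees inside \<open>S\<close> were at least \<open>d\<close>, a path
      on \<open>d + 1\<close> vertices would exist. Deleting a vertex of smaller degree lowers
      \<open>dn S S\<close> by at most \<open>2 * (d - 1)\<close>.\<close>
    obtain v where v: "v \<in> S" "card (nb S v) < d"
    proof (rule ccontr)
      assume "\<not> thesis"
      then have "\<And>v. v \<in> S \<Longrightarrow> d \<le> card (nb S v)" using that by force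
      from exists_long_path[OF psubset.prems(1) False this order.refl] psubset.prems(2)
      show False by blast
    qed
    let ?S = "S - {v}"
    have S: "insert v ?S = S" using v by blast
    have "dn ?S ?S \<le> 2 * (d - 1) * card ?S"
      using psubset.prems v by (intro psubset.IH) auto
    moreover have "dn S S = dn ?S ?S + 2 * card (nb ?S v)"
      using dn_insert_self[of ?S v] psubset.hyps S by simp
    moreover have "card (nb ?S v) \<le> d - 1"
      using card_nb_mono[of ?S S v] v by auto
    moreover have "card S = Suc (card ?S)"
      using v psubset.hyps by (metis card_Suc_Diff1)
    moreover have "2 * (d - 1) * Suc (card ?S) = 2 * (d - 1) * card ?S + 2 * (d - 1)" by simp
    ultimately have "dn S S \<le> 2 * (d - 1) * Suc (card ?S)" by linarith
    then show ?thesis unfolding \<open>card S = Suc (card ?S)\<close> .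
  qed
qed

lemma not_subset_if_card_less: "finite F \<Longrightarrow> card F < card S \<Longrightarrow> \<not> S \<subseteq> F"
  using card_mono leD by blast

text \<open>The path is built greedily and alternates between \<open>P\<close> and \<open>Y\<close>.
  \<open>F\<close> collects the forbidden and the used vertices; two more steps add two vertices to
  \<open>F\<close> and lower \<open>j\<close> by one, so \<open>card F + 2 * j\<close> does not grow
  and a fresh common neighbour is always left.\<close>

lemma link_even:
  assumes "P \<subseteq> V" "Y \<subseteq> V" "\<And>u w. u \<in> P \<Longrightarrow> w \<in> P \<Longrightarrow> K \<le> card (nb Y u \<inter> nb Y w)" "K \<le> card P"
    and "finite F" "card F + 2 * j < K" "u \<in> P" "w \<in> P" "u \<noteq> w" "u \<notin> F" "w \<notin> F"
  shows "\<exists>q. path q \<and> set q \<subseteq> P \<union> Y \<and> hd q = u \<and> last q = w \<and> length q = 2 * j + 3 \<and> set q \<inter> F = {}"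
  using assms(5-)
proof (induction j arbitrary: u F)
  case 0
  have "\<not> nb Y u \<inter> nb Y w \<subseteq> F"
    using 0 assms(3)[of u w] by (intro not_subset_if_card_less) linarith+
  then obtain y where y: "y \<in> Y" "adj u y" "adj w y" "y \<notin> F" by (auto simp: nb_def)
  have "u \<noteq> y" "w \<noteq> y" using y adj_irrefl by blast+
  then have "path [u, y, w]"
    using 0 y adj_V[of u y] adj_V2[of u y] adj_V[of w y] adj_sym[of w y] by (simp add: path_def)
  then show ?case using 0 y by (intro exI[of _ "[u, y, w]"]) simp
next
  case (Suc j)
  have "card (insert u (insert w F)) \<le> card F + 2" by (simp add: card_insert_if Suc.prems(1))
  then have "\<not> P \<subseteq> insert u (insert w F)"
    using Suc.prems assms(4) by (intro not_subset_if_card_less) auto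
  then obtain v where v: "v \<in> P" "v \<notin> F" "v \<noteq> u" "v \<noteq> w" by blast
  have "card (insert w F) \<le> card F + 1" by (simp add: card_insert_if Suc.prems(1))
  then have "\<not> nb Y u \<inter> nb Y v \<subseteq> insert w F"
    using Suc.prems v assms(3)[of u v] by (intro not_subset_if_card_less) auto
  then obtain y where y: "y \<in> Y" "adj u y" "adj v y" "y \<notin> F" "y \<noteq> w" by (auto simp: nb_def)
  have ne: "u \<noteq> y" "v \<noteq> y" using y adj_irrefl by blast+
  have "card (insert u (insert y F)) \<le> card F + 2" by (simp add: card_insert_if Suc.prems(1))
  then have "\<exists>q. path q \<and> set q \<subseteq> P \<union> Y \<and> hd q = v \<and> last q = w \<and> length q = 2 * j + 3
      \<and> set q \<inter> insert u (insert y F) = {}"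
    using Suc.prems v y ne by (intro Suc.IH) auto
  then obtain q where q: "path q" "set q \<subseteq> P \<union> Y" "hd q = v" "last q = w" "length q = 2 * j + 3"
    "set q \<inter> insert u (insert y F) = {}" by blast
  have "q \<noteq> []" using q by auto
  have "path (u # y # q)"
    using q y ne adj_V[of u y] adj_V2[of u y] adj_sym[of v y] by (simp add: path_Cons)
  moreover have "set (u # y # q) \<inter> F = {}" using q y Suc.prems by auto
  moreover have "set (u # y # q) \<subseteq> P \<union> Y" using q y Suc.prems by auto
  ultimately show ?case
    using q \<open>q \<noteq> []\<close> by (intro exI[of _ "u # y # q"]) simp
qed

end

subsection \<open>Odd ears and linked vertex classes\<close>

context fgraph
begin

text \<open>An odd ear of a vertex set with two classes \<open>A\<close> and \<open>B\<close>: a path with both ends in the set and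
  interior outside it, whose length has the parity that a two-colouring of a bipartite graph
  with colour classes \<open>A\<close> and \<open>B\<close> forbids. An edge inside a class is an odd ear.\<close>

definition odd_ear :: "'a set \<Rightarrow> 'a set \<Rightarrow> 'a list \<Rightarrow> bool" where
  "odd_ear A B p \<longleftrightarrow> path p \<and> 2 \<le> length p \<and> hd p \<in> A \<union> B \<and> last p \<in> A \<union> B \<and>
     set (butlast (tl p)) \<inter> (A \<union> B) = {} \<and> ((hd p \<in> A \<longleftrightarrow> last p \<in> A) \<longleftrightarrow> even (length p))"

text \<open>\<open>L\<close> counts edges. It starts at 2 because vertices in opposite classes of
  the core may fail to be adjacent. This is why an ear with \<open>2 * k - 1\<close> interior
  vertices cannot simply be closed up.\<close>

definition linked :: "nat \<Rightarrow> 'a set \<Rightarrow> 'a set \<Rightarrow> bool" where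
  "linked k A B \<longleftrightarrow> (\<forall>u\<in>A \<union> B. \<forall>w\<in>A \<union> B. u \<noteq> w \<longrightarrow>
     (\<forall>L. 2 \<le> L \<longrightarrow> L \<le> 2 * k \<longrightarrow> (even L \<longleftrightarrow> (u \<in> A \<longleftrightarrow> w \<in> A)) \<longrightarrow>
       (\<exists>q. path q \<and> set q \<subseteq> A \<union> B \<and> hd q = u \<and> last q = w \<and> length q = Suc L)))"

lemma length_ge_2_conv: "2 \<le> length p \<longleftrightarrow> (\<exists>x m y. p = x # m @ [y])"
proof
  assume "2 \<le> length p"
  then show "\<exists>x m y. p = x # m @ [y]"
    by (cases p; cases "tl p" rule: rev_cases) auto
qed auto

lemma odd_ear_conv:
  "odd_ear A B p \<longleftrightarrow> (\<exists>x m y. p = x # m @ [y] \<and> path (x # m @ [y]) \<and> x \<in> A \<union> B \<and> y \<in> A \<union> B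
     \<and> set m \<inter> (A \<union> B) = {} \<and> ((x \<in> A \<longleftrightarrow> y \<in> A) \<longleftrightarrow> even (length m)))"
  unfolding odd_ear_def length_ge_2_conv by (auto simp: butlast_append)

lemma odd_ear_rev: "odd_ear A B p \<Longrightarrow> odd_ear A B (rev p)"
proof -
  assume "odd_ear A B p"
  then obtain x m y where *: "p = x # m @ [y]" "path (x # m @ [y])" "x \<in> A \<union> B" "y \<in> A \<union> B"
    "set m \<inter> (A \<union> B) = {}" "(x \<in> A \<longleftrightarrow> y \<in> A) \<longleftrightarrow> even (length m)"
    unfolding odd_ear_conv by blast
  have "path (y # rev m @ [x])" using path_rev[OF *(2)] by simp
  then show ?thesis
    unfolding odd_ear_conv using * by (intro exI[of _ y] exI[of _ "rev m"] exI[of _ x]) auto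
qed

lemma odd_ear_swap: "A \<inter> B = {} \<Longrightarrow> odd_ear A B p \<Longrightarrow> odd_ear B A p"
  unfolding odd_ear_def by (auto simp: disjoint_iff)

text \<open>An ear with \<open>length m\<close> interior vertices has \<open>length m + 1\<close>
  edges, and a core path with \<open>2 * k - length m\<close> edges between its ends completes a
  cycle of length \<open>2 * k + 1\<close>. The parity of an odd ear is the one for which
  \<open>linked\<close> supplies this path.\<close>

lemma length_odd_ear:
  assumes free: "avoids_cycle (2 * k + 1)" and "linked k A B" and ear: "odd_ear A B p"
  shows "2 * k + 1 \<le> length p"
proof (rule ccontr)
  assume "\<not> ?thesis"
  then have le: "length p \<le> 2 * k" by simp
  obtain x m y where p: "p = x # m @ [y]" "path (x # m @ [y])" "x \<in> A \<union> B" "y \<in> A \<union> B"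
    "set m \<inter> (A \<union> B) = {}" "(x \<in> A \<longleftrightarrow> y \<in> A) \<longleftrightarrow> even (length m)"
    using ear unfolding odd_ear_conv by blast
  define L where "L = 2 * k - length m"
  have L: "2 \<le> L" "L \<le> 2 * k" "length m + L = 2 * k" using le p(1) by (auto simp: L_def)
  have "even L \<longleftrightarrow> even (length m)" using L(3) by (metis dvd_triv_left even_add)
  then have par: "even L \<longleftrightarrow> (y \<in> A \<longleftrightarrow> x \<in> A)" using p(6) by blast
  have "x \<noteq> y" using p(2) by (auto simp: path_def)
  then obtain q where q: "path q" "set q \<subseteq> A \<union> B" "hd q = y" "last q = x" "length q = Suc L"
    using assms(2) p(3,4) L(1,2) par unfolding linked_def by metis
  obtain y' r x' where "q = y' # r @ [x']" using q(5) L(1) length_ge_2_conv[of q] by auto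
  then have q': "q = y # r @ [x]" using q by auto
  then have "length r = L - 1" using q(5) by simp
  then have "r \<noteq> []" using L(1) by auto
  have r: "path r" "x \<notin> set r" "y \<notin> set r" "adj y (hd r)" "adj (last r) x" "set r \<subseteq> A \<union> B"
    using q(1,2) \<open>r \<noteq> []\<close> unfolding q' path_Cons path_append by auto
  have "path ((x # m @ [y]) @ r)"
    using p(2,5) r unfolding path_append[of "x # m @ [y]" r] by auto
  moreover have "length ((x # m @ [y]) @ r) = 2 * k + 1"
    using L \<open>length r = L - 1\<close> by simp
  moreover have "adj (last ((x # m @ [y]) @ r)) (hd ((x # m @ [y]) @ r))"
    using r \<open>r \<noteq> []\<close> by simp
  ultimately show False using free unfolding avoids_cycle_def by blast
qed

section \<open>Vertices joined to more than half of a set\<close>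

text \<open>The surplus \<open>k\<close> over one half is chosen so that any two rich vertices have
  at least \<open>2 * k\<close> common neighbours in \<open>Y\<close>, enough for greedy linking up
  to length \<open>2 * k\<close>.\<close>

definition rich :: "nat \<Rightarrow> 'a set \<Rightarrow> 'a set" where
  "rich k Y = {v \<in> V. card Y + 2 * k \<le> 2 * card (nb Y v)}"

lemma card_common_nb:
  assumes "finite Y" "u \<in> rich k Y" "w \<in> rich k Y"
  shows "2 * k \<le> card (nb Y u \<inter> nb Y w)"
proof -
  have "card (nb Y u) + card (nb Y w) = card (nb Y u \<union> nb Y w) + card (nb Y u \<inter> nb Y w)"
    by (rule card_Un_Int) auto
  moreover have "card (nb Y u \<union> nb Y w) \<le> card Y"
    using assms(1) by (intro card_mono) (auto simp: nb_def)
  ultimately show ?thesis using assms by (auto simp: rich_def)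
qed

lemma card_le_rich:
  assumes "X \<subseteq> V" "Y \<subseteq> V" "X \<subseteq> rich k Y" "Y \<subseteq> rich k X" "Y \<noteq> {}"
  shows "2 * k \<le> card (rich k Y)"
proof -
  obtain y where "y \<in> Y" using assms by blast
  then have "card X + 2 * k \<le> 2 * card (nb X y)" using assms by (auto simp: rich_def)
  moreover have "card (nb X y) \<le> card X"
    using assms finite_V by (intro card_nb_le) (auto intro: finite_subset)
  moreover have "card X \<le> card (rich k Y)"
    using assms finite_V by (intro card_mono) (auto simp: rich_def)
  ultimately show ?thesis by linarith
qed

lemma rich_link_even:
  assumes "X \<subseteq> V" "Y \<subseteq> V" "X \<subseteq> rich k Y" "Y \<subseteq> rich k X" "Y \<noteq> {}"
    and "finite F" "card F + 2 * j < 2 * k" "u \<in> rich k Y" "w \<in> rich k Y" "u \<noteq> w" "u \<notin> F" "w \<notin> F"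
    shows "\<exists>q. path q \<and> set q \<subseteq> rich k Y \<union> rich k X \<and> hd q = u \<and> last q = w \<and> length q = 2 * j + 3 \<and> set q \<inter> F = {}"
proof -
  have "\<exists>q. path q \<and> set q \<subseteq> rich k Y \<union> Y \<and> hd q = u \<and> last q = w \<and> length q = 2 * j + 3 \<and> set q \<inter> F = {}"
  proof (rule link_even)
    show "rich k Y \<subseteq> V" by (auto simp: rich_def)
    show "\<And>u w. u \<in> rich k Y \<Longrightarrow> w \<in> rich k Y \<Longrightarrow> 2 * k \<le> card (nb Y u \<inter> nb Y w)"
      using assms finite_V by (intro card_common_nb) (auto intro: finite_subset)
    show "2 * k \<le> card (rich k Y)" by (rule card_le_rich[OF assms(1-5)])
  qed (use assms in auto)
  then show ?thesis using assms(4) by blast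
qed

text \<open>One step from \<open>u\<close> into \<open>Y\<close>, which lies in
  \<open>rich k X\<close>, reduces this to an even link in the other class that avoids
  \<open>u\<close> as well. Disjointness of the two classes is not yet available, hence the explicit
  \<open>u \<noteq> w\<close>; the set \<open>F\<close> is there for the proof of that
  disjointness.\<close>

lemma rich_link_odd:
  assumes "X \<subseteq> V" "Y \<subseteq> V" "X \<subseteq> rich k Y" "Y \<subseteq> rich k X" "X \<noteq> {}"
    and "finite F" "card F \<le> 1" "1 \<le> j" "j < k" "u \<in> rich k Y" "w \<in> rich k X" "u \<noteq> w" "u \<notin> F" "w \<notin> F"
  shows "\<exists>q. path q \<and> set q \<subseteq> rich k Y \<union> rich k X \<and> hd q = u \<and> last q = w \<and> length q = 2 * j + 2 \<and> set q \<inter> F = {}"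
proof -
  have "card (nb Y u) \<le> card Y"
    using assms(2) finite_V by (intro card_nb_le) (auto intro: finite_subset)
  then have "2 * k \<le> card (nb Y u)" using assms(10) by (simp add: rich_def)
  moreover have "card (insert w F) \<le> 2" using assms(6,7) by (simp add: card_insert_if)
  ultimately have "\<not> nb Y u \<subseteq> insert w F"
    using assms(6,8,9) by (intro not_subset_if_card_less) auto
  then obtain y where y: "y \<in> Y" "adj u y" "y \<noteq> w" "y \<notin> F" by (auto simp: nb_def)
  have "u \<noteq> y" using y adj_irrefl by blast
  have "card (insert u F) \<le> 2" using assms(6,7) by (simp add: card_insert_if)
  then have "\<exists>q. path q \<and> set q \<subseteq> rich k X \<union> rich k Y \<and> hd q = y \<and> last q = w \<and> length q = 2 * (j - 1) + 3
      \<and> set q \<inter> insert u F = {}"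
    using assms y \<open>u \<noteq> y\<close> by (intro rich_link_even) auto
  then obtain q where q: "path q" "set q \<subseteq> rich k X \<union> rich k Y" "hd q = y" "last q = w"
    "length q = 2 * (j - 1) + 3" "set q \<inter> insert u F = {}" by blast
  have "q \<noteq> []" using q by auto
  have "path (u # q)" using q y adj_V by (simp add: path_Cons)
  moreover have "set (u # q) \<subseteq> rich k Y \<union> rich k X" using q assms by auto
  ultimately show ?thesis
    using q assms \<open>q \<noteq> []\<close> by (intro exI[of _ "u # q"]) auto
qed

text \<open>A vertex \<open>v\<close> in both classes has a neighbour \<open>x\<close> in
  \<open>X\<close> and another neighbour \<open>y\<close> in \<open>Y\<close>. A path from
  \<open>x\<close> to \<open>y\<close> on \<open>2 * k\<close> vertices that avoids \<open>v\<close>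
  closes through \<open>v\<close> to a cycle of length \<open>2 * k + 1\<close>.\<close>

lemma rich_disjoint:
  assumes "avoids_cycle (2 * k + 1)" "2 \<le> k"
    and "X \<subseteq> V" "Y \<subseteq> V" "X \<subseteq> rich k Y" "Y \<subseteq> rich k X" "X \<noteq> {}"
  shows "rich k Y \<inter> rich k X = {}"
proof (rule ccontr)
  assume "rich k Y \<inter> rich k X \<noteq> {}"
  then obtain v where v: "v \<in> rich k Y" "v \<in> rich k X" by blast
  have "card (nb Y v) \<le> card Y" "card (nb X v) \<le> card X"
    using assms(3,4) finite_V by (auto intro!: card_nb_le intro: finite_subset)
  then have c: "2 * k \<le> card (nb Y v)" "2 * k \<le> card (nb X v)" using v by (auto simp: rich_def)
  have "\<not> nb Y v \<subseteq> {}" using c assms(2) by (intro not_subset_if_card_less) auto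
  then obtain y where y: "y \<in> Y" "adj v y" by (auto simp: nb_def)
  have "\<not> nb X v \<subseteq> {y}" using c assms(2) by (intro not_subset_if_card_less) auto
  then obtain x where x: "x \<in> X" "adj v x" "x \<noteq> y" by (auto simp: nb_def)
  have ne: "v \<noteq> x" "v \<noteq> y" using x y adj_irrefl by blast+
  have "\<exists>q. path q \<and> set q \<subseteq> rich k Y \<union> rich k X \<and> hd q = x \<and> last q = y \<and> length q = 2 * (k - 1) + 2
      \<and> set q \<inter> {v} = {}"
    using assms x y ne by (intro rich_link_odd[of X Y k]) auto
  then obtain q where q: "path q" "hd q = x" "last q = y" "length q = 2 * (k - 1) + 2" "v \<notin> set q"
    by blast
  have "q \<noteq> []" using q by auto
  have "path (v # q)" using q x adj_V[of v x] by (simp add: path_Cons)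
  moreover have "length (v # q) = 2 * k + 1" using q assms(2) by simp
  moreover have "adj (last (v # q)) (hd (v # q))" using q y \<open>q \<noteq> []\<close> adj_sym by simp
  ultimately show False using assms(1) unfolding avoids_cycle_def by blast
qed

lemma linked_rich:
  assumes "avoids_cycle (2 * k + 1)" "2 \<le> k"
    and XY: "X \<subseteq> V" "Y \<subseteq> V" "X \<subseteq> rich k Y" "Y \<subseteq> rich k X" "X \<noteq> {}" "Y \<noteq> {}"
  shows "linked k (rich k Y) (rich k X)"
  unfolding linked_def
proof (intro ballI impI allI)
  fix u w L
  assume u: "u \<in> rich k Y \<union> rich k X" and w: "w \<in> rich k Y \<union> rich k X" and "u \<noteq> w"
    and L: "2 \<le> L" "L \<le> 2 * k" and par: "even L \<longleftrightarrow> (u \<in> rich k Y \<longleftrightarrow> w \<in> rich k Y)"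
  note disj = rich_disjoint[OF assms(1-7)]
  let ?Q = "\<lambda>u w. \<exists>q. path q \<and> set q \<subseteq> rich k Y \<union> rich k X \<and> hd q = u \<and> last q = w \<and> length q = Suc L"
  have swap: "?Q w u \<Longrightarrow> ?Q u w"
    by (metis path_rev set_rev length_rev hd_rev last_rev)
  show "?Q u w"
  proof (cases "even L")
    case True
    then obtain j where "L = 2 * j" by blast
    with L have j: "Suc L = 2 * (j - 1) + 3" "2 * (j - 1) < 2 * k" by auto
    show ?thesis
    proof (cases "u \<in> rich k Y")
      case uY: True
      then have "w \<in> rich k Y" using True par by blast
      then show ?thesis
        using rich_link_even[OF XY(1-4) XY(6), of "{}" "j - 1" u w] uY j \<open>u \<noteq> w\<close> XY by auto
    next
      case False
      then have "u \<in> rich k X" "w \<in> rich k X" using True par u w by blast+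
      then show ?thesis
        using rich_link_even[OF XY(2,1) XY(4,3) XY(5), of "{}" "j - 1" u w] j \<open>u \<noteq> w\<close> XY by auto
    qed
  next
    case False
    then obtain j where "L = 2 * j + 1" using oddE by blast
    with L have j: "Suc L = 2 * j + 2" "1 \<le> j" "j < k" by auto
    show ?thesis
    proof (cases "u \<in> rich k Y")
      case uY: True
      then have "w \<in> rich k X" using False par w by blast
      then show ?thesis
        using rich_link_odd[OF XY(1-5), of "{}" j u w] uY j \<open>u \<noteq> w\<close> by auto
    next
      case uY: False
      then have "u \<in> rich k X" "w \<in> rich k Y" using False par u w by blast+
      then have "?Q w u"
        using rich_link_odd[OF XY(1-5), of "{}" j w u] j \<open>u \<noteq> w\<close> by auto
      then show ?thesis by (rule swap)
    qed
  qed
qed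

end

subsection \<open>A linked core\<close>

text \<open>Here \<open>a\<close> and \<open>b\<close> are the class sizes and \<open>M\<close> is
  the number of missing pairs between the classes. The first-order error is
  \<open>n * n / 126\<close>; the term of order \<open>k * k\<close> is absorbed by weakening 126 to
  120. Integers are used because \<open>b - a\<close> may be negative.\<close>

lemma partition_arith:
  fixes a b k t M n :: int
  assumes "0 \<le> M" "2 \<le> k" "1 \<le> t" "n = a + b" "252 * t\<^sup>2 * k \<le> n"
    and M: "2 * M \<le> 4 * (t + k - 1) * n + 4 * (k - 1) * (b - a) - (b - a)\<^sup>2"
  shows "120 * M \<le> n\<^sup>2 \<and> 6 * \<bar>b - a\<bar> \<le> n"
proof -
  have "0 \<le> (t - 1) * (k - 1)" using assms by simp
  then have "t + k - 1 \<le> t * k" by (simp add: algebra_simps)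
  also have "\<dots> \<le> t\<^sup>2 * k" using assms self_le_power[of t 2] by (intro mult_right_mono) auto
  finally have "t + k - 1 \<le> t\<^sup>2 * k" .
  then have "252 * (t + k - 1) \<le> 252 * (t\<^sup>2 * k)" by (rule mult_left_mono) simp
  also have "\<dots> \<le> n" using assms(5) by (simp add: mult.assoc)
  finally have tk: "252 * (t + k - 1) \<le> n" .
  then have k: "252 * (k - 1) \<le> n" using assms(3) by simp
  then have n0: "0 \<le> n" using assms(2) by simp
  have tkn: "252 * ((t + k - 1) * n) \<le> n * n"
    using mult_right_mono[OF tk n0] by (simp add: algebra_simps)
  have kn: "63504 * ((k - 1) * (k - 1)) \<le> n * n"
  proof -
    have "(252 * (k - 1)) * (252 * (k - 1)) \<le> n * n"
      using k n0 assms by (intro mult_mono) auto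
    then show ?thesis by (simp add: algebra_simps)
  qed
  define d where "d = b - a"
  define x where "x = \<bar>d\<bar>"
  have M': "2 * M \<le> 4 * ((t + k - 1) * n) + 4 * ((k - 1) * d) - d * d"
    using M by (simp add: d_def power2_eq_square algebra_simps)
  have "0 \<le> (d - 2 * (k - 1)) * (d - 2 * (k - 1))" by (rule zero_le_square)
  then have sq: "4 * ((k - 1) * d) - d * d \<le> 4 * ((k - 1) * (k - 1))"
    by (simp add: algebra_simps)
  have "120 * M \<le> N" if "252 * T \<le> N" "63504 * Q \<le> N" "2 * M \<le> 4 * T + P - D" "P - D \<le> 4 * Q" "0 \<le> N"
    for T N Q P D :: int using that by linarith
  from this[OF tkn kn M' sq zero_le_square] have 1: "120 * M \<le> n\<^sup>2" by (simp add: power2_eq_square)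
  have "6 * x \<le> n"
  proof (rule ccontr)
    assume "\<not> ?thesis"
    \<comment> \<open>Dropping \<open>M\<close> gives \<open>63 * x * x <= n * n + n * x\<close>,
      whereas \<open>n < 6 * x\<close> bounds the right side by \<open>42 * x * x\<close>.\<close>
    then have x: "n < 6 * x" by simp
    have le: "(k - 1) * d \<le> (k - 1) * x" using assms unfolding x_def by (intro mult_left_mono) auto
    have dx: "d * d = x * x" by (simp add: x_def)
    have kx: "252 * ((k - 1) * x) \<le> n * x"
      using mult_right_mono[OF k, of x] by (simp add: x_def algebra_simps)
    have "63 * X \<le> N + Y" if "252 * T \<le> N" "2 * M \<le> 4 * T + 4 * U - D" "U \<le> W" "D = X" "252 * W \<le> Y"
      for T N U D W X Y :: int using that assms(1) by linarith
    from this[OF tkn M' le dx kx] have "63 * (x * x) \<le> n * n + n * x" .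
    moreover have "n * n \<le> 6 * (n * x)" using mult_left_mono[of n "6 * x" n] x n0 by simp
    moreover have "n * x \<le> 6 * (x * x)" using mult_right_mono[of n "6 * x" x] x by (simp add: x_def)
    moreover have "0 < x * x" using x n0 by simp
    ultimately show False by linarith
  qed
  with 1 show ?thesis by (simp add: x_def d_def)
qed

context fgraph
begin

lemma finite_sub: "S \<subseteq> V \<Longrightarrow> finite S"
  using finite_V finite_subset by blast

text \<open>\<open>B\<close> is the neighbourhood of a vertex \<open>v\<close> of maximum degree, so
  the degrees in \<open>A\<close> sum to at most \<open>card A * card B\<close>. Thus the degree sum
  inside \<open>A\<close> is paid for by missing pairs between \<open>A\<close> and
  \<open>B\<close>. A path on \<open>2 * k\<close> vertices inside \<open>B\<close> would close
  through \<open>v\<close> to a forbidden cycle.\<close>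

lemma furedi_partition:
  assumes "avoids_cycle (2 * k + 1)" "2 \<le> k" "V \<noteq> {}"
  shows "\<exists>A B. A \<union> B = V \<and> A \<inter> B = {} \<and> dn A A + dn A B \<le> card A * card B
    \<and> dn B B \<le> 4 * (k - 1) * card B"
proof -
  define \<Delta> where "\<Delta> = Max ((\<lambda>v. card (nb V v)) ` V)"
  have "\<Delta> \<in> (\<lambda>v. card (nb V v)) ` V"
    unfolding \<Delta>_def using assms(3) finite_V by (intro Max_in) auto
  then obtain v where v: "v \<in> V" "\<Delta> = card (nb V v)" by blast
  have max: "card (nb V w) \<le> \<Delta>" if "w \<in> V" for w
    unfolding \<Delta>_def using that finite_V by (intro Max_ge) auto
  define B where "B = nb V v"
  define A where "A = V - B"
  have AB: "A \<union> B = V" "A \<inter> B = {}" "A \<subseteq> V" "B \<subseteq> V" by (auto simp: A_def B_def nb_def)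
  have "dn A A + dn A B = dn A V" using dn_Un_right[OF AB(2), of A] AB(1) by simp
  also have "\<dots> \<le> card A * \<Delta>"
    unfolding dn_def using sum_bounded_above[of A "\<lambda>w. card (nb V w)" \<Delta>] max AB(3) by auto
  finally have 1: "dn A A + dn A B \<le> card A * card B" by (simp add: v B_def)
  have "length p \<noteq> Suc (2 * k - 1)" if p: "path p" "set p \<subseteq> B" for p
  proof
    assume len: "length p = Suc (2 * k - 1)"
    then have ne: "p \<noteq> []" by auto
    have "hd p \<in> B" "last p \<in> B" using p ne by auto
    then have adj: "adj v (hd p)" "adj v (last p)" by (auto simp: B_def nb_def)
    have "v \<notin> set p" using p adj_irrefl by (auto simp: B_def nb_def)
    then have "path (v # p)" using p adj v by (simp add: path_Cons)
    moreover have "length (v # p) = 2 * k + 1" using len assms(2) by simp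
    moreover have "adj (last (v # p)) (hd (v # p))" using ne adj adj_sym by simp
    ultimately show False using assms(1) unfolding avoids_cycle_def by blast
  qed
  then have "dn B B \<le> 2 * (2 * k - 1 - 1) * card B"
    using assms(2) AB by (intro dn_le_if_no_path) auto
  moreover have "2 * (2 * k - 1 - 1) = 4 * (k - 1)" by simp
  ultimately have "dn B B \<le> 4 * (k - 1) * card B" by simp
  then show ?thesis using 1 AB by blast
qed

text \<open>A poor vertex of \<open>A\<close> misses more than \<open>n / 7\<close> vertices of
  \<open>B\<close>, and at most \<open>n * n / 120\<close> pairs are missing altogether.\<close>

lemma few_poor:
  assumes "finite A" "finite B" "120 * (card A * card B) \<le> 120 * dn A B + n\<^sup>2" "0 < n"
  shows "120 * card {w \<in> A. \<not> 7 * card B \<le> 7 * card (nb B w) + n} \<le> 7 * n"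
proof -
  let ?P = "{w \<in> A. \<not> 7 * card B \<le> 7 * card (nb B w) + n}"
  have "card ?P * n = (\<Sum>w\<in>?P. n)" by simp
  also have "\<dots> \<le> (\<Sum>w\<in>?P. 7 * (card B - card (nb B w)))" by (rule sum_mono) auto
  also have "\<dots> \<le> (\<Sum>w\<in>A. 7 * (card B - card (nb B w)))"
    by (rule sum_mono2) (use assms in auto)
  also have "\<dots> = 7 * (\<Sum>w\<in>A. card B - card (nb B w))" by (simp add: sum_distrib_left)
  finally have 1: "card ?P * n \<le> 7 * (\<Sum>w\<in>A. card B - card (nb B w))" .
  have "(\<Sum>w\<in>A. card B - card (nb B w)) + dn A B = (\<Sum>w\<in>A. card B)"
    unfolding dn_def sum.distrib[symmetric] by (intro sum.cong) (auto simp: card_nb_le assms)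
  then have "(\<Sum>w\<in>A. card B - card (nb B w)) + dn A B = card A * card B" by simp
  then have "120 * card ?P * n \<le> 7 * n\<^sup>2" using 1 assms(3) by linarith
  then have "(120 * card ?P) * n \<le> (7 * n) * n" by (simp add: power2_eq_square)
  then show ?thesis using assms(4) by simp
qed

text \<open>Missing at most \<open>n / 7\<close> vertices of \<open>B\<close> leaves half of
  \<open>B'\<close> and \<open>k\<close> more once \<open>card B'\<close> is at least
  \<open>2 * n / 7 + 2 * k\<close>.\<close>

lemma well_joined_rich:
  assumes "B' \<subseteq> B" "B \<subseteq> V" "w \<in> V" "7 * card B \<le> 7 * card (nb B w) + n" "2 * n + 14 * k \<le> 7 * card B'"
  shows "w \<in> rich k B'"
proof -
  have "B = B' \<union> (B - B')" using assms by blast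
  then have "card (nb B w) = card (nb B' w) + card (nb (B - B') w)"
    using card_nb_Un[of B' "B - B'" w] by (metis Diff_disjoint)
  moreover have "card (nb (B - B') w) \<le> card (B - B')"
    using assms finite_sub by (intro card_nb_le) auto
  moreover have "card (B - B') + card B' = card B"
    using assms finite_sub[of B] by (metis card_mono card_Diff_subset finite_subset le_add_diff_inverse2)
  ultimately show ?thesis using assms by (simp add: rich_def)
qed

lemma degree_of_poor:
  assumes "X \<union> Y \<subseteq> V" "X \<inter> Y = {}" "v \<in> V" "v \<notin> rich k Y" "nb X v = {}"
  shows "2 * card (nb V v) \<le> card Y + 2 * k + 2 * card (V - (X \<union> Y))"
proof -
  have "V = X \<union> (Y \<union> (V - (X \<union> Y)))" using assms by blast
  then have "nb V v = nb X v \<union> (nb Y v \<union> nb (V - (X \<union> Y)) v)" by (metis nb_Un)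
  then have "card (nb V v) \<le> card (nb Y v) + card (nb (V - (X \<union> Y)) v)"
    using assms(5) card_Un_le by simp
  moreover have "card (nb (V - (X \<union> Y)) v) \<le> card (V - (X \<union> Y))"
    by (rule card_nb_le) (simp add: finite_V)
  moreover have "2 * card (nb Y v) < card Y + 2 * k" using assms(3,4) by (simp add: rich_def)
  ultimately show ?thesis by linarith
qed

text \<open>The core consists of \<open>rich k Y\<close> and \<open>rich k X\<close>, not of the
  well-joined sets \<open>X\<close> and \<open>Y\<close> themselves. Then a vertex outside the core
  is poor towards both \<open>X\<close> and \<open>Y\<close>; it has neighbours in only one of them,
  and in at most about half of that one.\<close>

lemma core_exists:
  assumes free: "avoids_cycle (2 * k + 1)" and k: "2 \<le> k" and t: "1 \<le> t"
    and n: "card V = n" "252 * t\<^sup>2 * k \<le> n" and e: "n * n \<le> 2 * dn V V + 4 * t * n"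
  shows "\<exists>A B. A \<union> B \<subseteq> V \<and> A \<inter> B = {} \<and> linked k A B \<and> 8 * card (V - (A \<union> B)) \<le> n
    \<and> (\<forall>v\<in>V - (A \<union> B). 12 * card (nb V v) \<le> 5 * n)"
proof -
  have "k \<le> t\<^sup>2 * k" using t by simp
  then have kn: "252 * k \<le> n" using n(2) by linarith
  then have n0: "0 < n" using k by linarith
  then have "V \<noteq> {}" using n by auto
  then obtain A B where AB: "A \<union> B = V" "A \<inter> B = {}"
    and DA: "dn A A + dn A B \<le> card A * card B" and DB: "dn B B \<le> 4 * (k - 1) * card B"
    using furedi_partition[OF free k] by blast
  have fin: "finite A" "finite B" "A \<subseteq> V" "B \<subseteq> V" using AB finite_V by auto
  have nab: "n = card A + card B" using AB fin n card_Un_disjoint by metis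
  have dV: "dn V V = dn A A + 2 * dn A B + dn B B"
    using dn_Un_self[OF fin(1,2) AB(2)] AB(1) by simp
  \<comment> \<open>\<open>M\<close> counts the missing pairs between \<open>A\<close> and
    \<open>B\<close>, and \<open>furedi_partition\<close> says that it is at least
    \<open>dn A A\<close>.\<close>
  define a b M where "a = int (card A)" and "b = int (card B)" and "M = a * b - int (dn A B)"
  have DA': "int (dn A A) \<le> M" using DA unfolding a_def b_def M_def
    by (metis add.commute le_diff_eq of_nat_add of_nat_le_iff of_nat_mult)
  have "120 * M \<le> (int n)\<^sup>2 \<and> 6 * \<bar>b - a\<bar> \<le> int n"
  proof (rule partition_arith[where k = "int k" and t = "int t"])
    have "int (252 * t\<^sup>2 * k) \<le> int n" using n(2) by (subst of_nat_le_iff)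
    then show "252 * (int t)\<^sup>2 * int k \<le> int n" by simp
    show "0 \<le> M" using DA' by linarith
    have "int (dn B B) \<le> int (4 * (k - 1) * card B)" using DB by (subst of_nat_le_iff)
    then have DB': "int (dn B B) \<le> 4 * ((int k - 1) * b)" using k by (simp add: b_def of_nat_diff algebra_simps)
    have lin: "N \<le> 2 * (x + 2 * (y - M) + z) + 4 * u \<Longrightarrow> z \<le> 4 * w \<Longrightarrow> x \<le> M
        \<Longrightarrow> 2 * M \<le> 4 * y + 2 * (4 * w) + 4 * u - N" for N x y z u w :: int
      by simp
    have "int (n * n) \<le> int (2 * dn V V + 4 * t * n)" using e by (subst of_nat_le_iff)
    then have "int n * int n \<le> 2 * (int (dn A A) + 2 * (a * b - M) + int (dn B B)) + 4 * (int t * int n)"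
      unfolding dV by (simp add: M_def)
    then have "2 * M \<le> 4 * (a * b) + 2 * (4 * ((int k - 1) * b)) + 4 * (int t * int n) - int n * int n"
      using DB' DA' lin by blast
    then show "2 * M \<le> 4 * (int t + int k - 1) * int n + 4 * (int k - 1) * (b - a) - (b - a)\<^sup>2"
      unfolding nab a_def b_def by (simp add: algebra_simps power2_eq_square)
  qed (use k t nab in \<open>auto simp: a_def b_def\<close>)
  then have M: "120 * M \<le> (int n)\<^sup>2" and ab: "6 * \<bar>b - a\<bar> \<le> int n" by auto
  have size: "5 * n \<le> 12 * card A" "5 * n \<le> 12 * card B" "12 * card A \<le> 7 * n" "12 * card B \<le> 7 * n"
  proof -
    have "6 * b \<le> int n + 6 * a" "6 * a \<le> int n + 6 * b" using ab by (simp_all add: abs_le_iff abs_if split: if_splits)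
    then show "5 * n \<le> 12 * card A" "5 * n \<le> 12 * card B" "12 * card A \<le> 7 * n" "12 * card B \<le> 7 * n"
      using nab unfolding a_def b_def by linarith+
  qed
  have "int (120 * (card A * card B)) \<le> int (120 * dn A B + n\<^sup>2)"
    using M unfolding M_def a_def b_def by simp
  then have M': "120 * (card A * card B) \<le> 120 * dn A B + n\<^sup>2" by (subst (asm) of_nat_le_iff)
  then have M'': "120 * (card B * card A) \<le> 120 * dn B A + n\<^sup>2"
    using dn_commute[OF fin(1,2)] by (simp add: mult.commute)
  define X where "X = {w \<in> A. 7 * card B \<le> 7 * card (nb B w) + n}"
  define Y where "Y = {w \<in> B. 7 * card A \<le> 7 * card (nb A w) + n}"
  have XY: "X \<subseteq> A" "Y \<subseteq> B" "X \<subseteq> V" "Y \<subseteq> V" "X \<union> Y \<subseteq> V" "X \<inter> Y = {}" "finite X" "finite Y"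
    using fin AB by (auto simp: X_def Y_def)
  have "A - X = {w \<in> A. \<not> 7 * card B \<le> 7 * card (nb B w) + n}" by (auto simp: X_def)
  then have cX: "120 * card (A - X) \<le> 7 * n" using few_poor[OF fin(1,2) M' n0] by simp
  have "B - Y = {w \<in> B. \<not> 7 * card A \<le> 7 * card (nb A w) + n}" by (auto simp: Y_def)
  then have cY: "120 * card (B - Y) \<le> 7 * n" using few_poor[OF fin(2,1) M'' n0] by simp
  have sX: "card (A - X) + card X = card A" and sY: "card (B - Y) + card Y = card B"
    using XY fin by (metis card_mono card_Diff_subset finite_subset le_add_diff_inverse2)+
  have "2 * n + 14 * k \<le> 7 * card X" using cX sX size kn by linarith
  then have YX: "Y \<subseteq> rich k X"
    using well_joined_rich[OF XY(1) fin(3), of _ n k] fin by (auto simp: Y_def)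
  have "2 * n + 14 * k \<le> 7 * card Y" using cY sY size kn by linarith
  then have XrY: "X \<subseteq> rich k Y"
    using well_joined_rich[OF XY(2) fin(4), of _ n k] fin by (auto simp: X_def)
  have "card X \<noteq> 0" "card Y \<noteq> 0" using cX sX cY sY size n0 by linarith+
  then have ne: "X \<noteq> {}" "Y \<noteq> {}" by auto
  have disj: "rich k Y \<inter> rich k X = {}" by (rule rich_disjoint[OF free k XY(3,4) XrY YX ne(1)])
  have lk: "linked k (rich k Y) (rich k X)" by (rule linked_rich[OF free k XY(3,4) XrY YX ne])
  have "V - (X \<union> Y) = (A - X) \<union> (B - Y)" using AB XY by blast
  then have "card (V - (X \<union> Y)) \<le> card (A - X) + card (B - Y)" by (simp add: card_Un_le)
  then have bad: "120 * card (V - (X \<union> Y)) \<le> 14 * n" using cX cY by linarith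
  have "card (V - (rich k Y \<union> rich k X)) \<le> card (V - (X \<union> Y))"
    using XrY YX finite_V by (intro card_mono) auto
  then have 1: "8 * card (V - (rich k Y \<union> rich k X)) \<le> n" using bad n0 by linarith
  have 2: "12 * card (nb V v) \<le> 5 * n" if v: "v \<in> V - (rich k Y \<union> rich k X)" for v
  proof -
    \<comment> \<open>Otherwise \<open>v\<close> with a neighbour on each side is an odd ear on
      three vertices, fewer than \<open>2 * k + 1\<close>.\<close>
    have "nb X v = {} \<or> nb Y v = {}"
    proof (rule ccontr)
      assume "\<not> ?thesis"
      then obtain x y where xy: "x \<in> X" "adj v x" "y \<in> Y" "adj v y" by (auto simp: nb_def)
      then have C: "x \<in> rich k Y" "y \<in> rich k X" "x \<notin> rich k X" "y \<notin> rich k Y"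
        using XrY YX disj by auto
      have "path [x, v, y]"
        using xy XY v adj_irrefl adj_sym C by (auto simp: path_def)
      then have "odd_ear (rich k Y) (rich k X) [x, v, y]"
        using C v by (auto simp: odd_ear_def)
      from length_odd_ear[OF free lk this] k show False by simp
    qed
    then show ?thesis
    proof
      assume "nb X v = {}"
      from degree_of_poor[OF XY(5,6) _ _ this, of k] v bad
      have "2 * card (nb V v) \<le> card Y + 2 * k + 2 * card (V - (X \<union> Y))" by auto
      then show ?thesis using bad kn size(4) sY by linarith
    next
      assume "nb Y v = {}"
      from degree_of_poor[OF _ _ _ _ this, of X k] v XY
      have "2 * card (nb V v) \<le> card X + 2 * k + 2 * card (V - (X \<union> Y))"
        by (auto simp: Un_commute Int_commute)
      then show ?thesis using bad kn size(3) sX by linarith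
    qed
  qed
  have "rich k Y \<union> rich k X \<subseteq> V" by (auto simp: rich_def)
  then show ?thesis using disj lk 1 2 by blast
qed

end

subsection \<open>Shortest odd ears\<close>

lemma two_mult_choose_two: "2 * (m choose 2) = m * (m - 1)"
proof -
  have "even (m * (m - 1))" by (cases m) auto
  then show ?thesis by (simp add: choose_two)
qed

lemma four_mult_le_square: "4 * (a * b) \<le> (a + b) * (a + b)" for a b :: nat
proof -
  have "0 \<le> (int a - int b) * (int a - int b)" by (rule zero_le_square)
  then have "int (4 * (a * b)) \<le> int ((a + b) * (a + b))" by (simp add: algebra_simps)
  then show ?thesis by (subst (asm) of_nat_le_iff)
qed

lemma square_le_four_div: "m * m \<le> 4 * (m\<^sup>2 div 4) + 3" for m :: nat
  unfolding power2_eq_square by presburger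

text \<open>\<open>w\<close> vertices of degree at most \<open>5 * n / 12\<close> are traded for
  vertices of a balanced bipartite graph on \<open>N\<close> vertices. After scaling by 6, the
  surplus 2 in the bound on \<open>T\<close> is worth 12, which outweighs the loss of at most 9 from
  rounding \<open>N * N / 4\<close>.\<close>

lemma short_ear_arith:
  fixes n k w N a b D T :: nat
  assumes "N + 2 * k = n + 1" "a + b + w = N" "252 * k \<le> n" "8 * w \<le> n"
    and D: "6 * D \<le> 6 * T + 5 * (n * w)" and T: "T + 2 \<le> 2 * (a * b) + 2 * k * (2 * k - 1)"
  shows "D < 2 * (N\<^sup>2 div 4 + (2 * k choose 2))"
proof -
  define c where "c = a + b"
  have "5 * n \<le> 6 * c + 3 * w" using assms(1-4) by (simp add: c_def)
  then have "5 * n * w \<le> (6 * c + 3 * w) * w" by (rule mult_right_mono) simp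
  then have "5 * (n * w) \<le> 6 * (c * w) + 3 * (w * w)" by (simp add: algebra_simps)
  moreover have "N * N = c * c + 2 * (c * w) + w * w"
    using assms(2) by (simp add: c_def algebra_simps flip: assms(2))
  moreover have "4 * (a * b) \<le> c * c" unfolding c_def by (rule four_mult_le_square)
  ultimately have "12 * (a * b) + 5 * (n * w) \<le> 3 * (N * N)" by linarith
  moreover note square_le_four_div[of N] D T two_mult_choose_two[of "2 * k"]
  ultimately show ?thesis by simp
qed

text \<open>Here the ear has \<open>s\<close> interior vertices more than \<open>2 * k - 1\<close>.
  Each of these reduces the bipartite part by one vertex, at a cost of about \<open>n / 2\<close>.
  With \<open>2 <= s\<close> this exceeds the \<open>5 * n / 6\<close> that the two outermost
  interior vertices can contribute; with \<open>s = 1\<close> it would not.\<close>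

lemma long_ear_arith:
  fixes n k w N a b D T :: nat
  assumes N: "N + 2 * k = n + 1" and c: "a + b + w + s = N" and n: "252 * k \<le> n" "2 \<le> k" and sw: "8 * (s + w) \<le> n"
    and s: "2 \<le> s" and r: "r + 1 = s + 2 * k"
    and D: "6 * D \<le> 6 * T + 5 * (n * w)" and T: "6 * T + 24 \<le> 12 * (a * b) + 10 * n + 6 * (r * (r + 1))"
  shows "D < 2 * (N\<^sup>2 div 4 + (2 * k choose 2))"
proof -
  define c where "c = a + b"
  have c84: "84 * c + 1 \<ge> 72 * n + 84 + 56"
    using N c n sw by (simp add: c_def)
  have w: "5 * (n * w) \<le> 6 * (c * w)"
    using mult_right_mono[of "5 * n" "6 * c" w] c84 by (simp add: algebra_simps)
  have s': "10 * n + 6 * (s * s) + 24 * (s * k) \<le> 6 * (c * s) + 3 * (s * s)"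
  proof (cases "s = 2")
    case True
    then show ?thesis using N c n sw by (simp add: c_def)
  next
    case False
    then have "3 \<le> s" using s by simp
    then have "n * 3 \<le> n * s" by (rule mult_left_mono) simp
    moreover have "8 * (s * s) \<le> n * s"
      using mult_right_mono[of "8 * s" n s] sw by (simp add: mult.assoc)
    moreover have "252 * (s * k) \<le> n * s"
      using mult_left_mono[OF n(1), of s] by (simp add: ac_simps)
    moreover have "72 * (n * s) \<le> 84 * (c * s)"
      using mult_right_mono[of "72 * n" "84 * c" s] c84 by (simp only: mult.assoc)
    ultimately show ?thesis by linarith
  qed
  have "N * N = c * c + 2 * (c * w) + 2 * (c * s) + (w * w + 2 * (w * s)) + s * s"
    unfolding c[symmetric] c_def by (simp add: algebra_simps)
  moreover have "4 * (a * b) \<le> c * c" unfolding c_def by (rule four_mult_le_square)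
  moreover have "r * (r + 1) + s = s * s + 4 * (s * k) + 2 * k * (2 * k - 1)"
  proof -
    obtain j where "k = Suc j" using n(2) by (cases k) auto
    then have "r = s + 2 * j + 1" using r by simp
    then show ?thesis by (simp add: \<open>k = Suc j\<close> algebra_simps)
  qed
  moreover have "12 * x + 10 * n + 6 * R + 5 * y < 12 * q + 12 * C + 24"
    if "NN = cc + 2 * cw + 2 * cs + z + ss" "4 * x \<le> cc" "R + s = ss + 4 * sk + 2 * C" "5 * y \<le> 6 * cw"
      "10 * n + 6 * ss + 24 * sk \<le> 6 * cs + 3 * ss" "NN \<le> 4 * q + 3"
    for NN cc cw cs z ss x R sk C y q :: nat using that by linarith
  from this[OF calculation(1,2) _ w s' square_le_four_div[of N], of "r * (r + 1)" "(2 * k) choose 2"]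
    calculation(3) two_mult_choose_two[of "2 * k"]
  have "12 * (a * b) + 10 * n + 6 * (r * (r + 1)) + 5 * (n * w) < 12 * (N\<^sup>2 div 4) + 12 * (2 * k choose 2) + 24"
    by simp
  then have "6 * D < 12 * (N\<^sup>2 div 4) + 12 * (2 * k choose 2)" using D T by linarith
  then show ?thesis by simp
qed

lemma card_sym_pairs:
  fixes I :: "nat set"
  assumes "finite I" "\<And>i j. R i j \<Longrightarrow> R j i" "\<And>i. \<not> R i i"
  shows "card {(i, j). i \<in> I \<and> j \<in> I \<and> R i j} = 2 * card {(i, j). i \<in> I \<and> j \<in> I \<and> i < j \<and> R i j}"
proof -
  let ?E = "{(i, j). i \<in> I \<and> j \<in> I \<and> i < j \<and> R i j}"
  have fin: "finite ?E" by (rule finite_subset[of _ "I \<times> I"]) (use assms in auto)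
  have "{(i, j). i \<in> I \<and> j \<in> I \<and> R i j} = ?E \<union> prod.swap ` ?E"
  proof -
    have "i < j \<or> j < i" if "R i j" for i j using that assms(3) by (metis linorder_neqE_nat)
    then show ?thesis using assms(2) by (force simp: image_iff)
  qed
  moreover have "?E \<inter> prod.swap ` ?E = {}" by auto
  moreover have "card (prod.swap ` ?E) = card ?E" by (simp add: card_image)
  ultimately show ?thesis using fin by (simp add: card_Un_disjoint)
qed

context fgraph
begin

text \<open>In this form the condition on the interior passes to any path with the same ends on a
  subset of the vertices, which is how shortened ears arise.\<close>

lemma odd_ear_alt:
  "odd_ear A B p \<longleftrightarrow> path p \<and> 2 \<le> length p \<and> hd p \<in> A \<union> B \<and> last p \<in> A \<union> B \<and>
     (\<forall>z\<in>set p. z \<in> A \<union> B \<longrightarrow> z = hd p \<or> z = last p) \<and> ((hd p \<in> A \<longleftrightarrow> last p \<in> A) \<longleftrightarrow> even (length p))"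
proof (cases "2 \<le> length p")
  case True
  then obtain x m y where p: "p = x # m @ [y]" unfolding length_ge_2_conv by blast
  have "set (butlast (tl p)) \<inter> (A \<union> B) = {} \<longleftrightarrow> (\<forall>z\<in>set p. z \<in> A \<union> B \<longrightarrow> z = hd p \<or> z = last p)"
    if "path p"
  proof -
    have "set (butlast (tl p)) = set m" "set p = insert x (insert y (set m))" "hd p = x" "last p = y"
      by (auto simp: p)
    moreover have "x \<notin> set m" "y \<notin> set m" using that by (auto simp: p path_def)
    ultimately show ?thesis by blast
  qed
  then show ?thesis unfolding odd_ear_def by blast
qed (simp add: odd_ear_def)

definition shortest_odd_ear :: "'a set \<Rightarrow> 'a set \<Rightarrow> 'a list \<Rightarrow> bool" where
  "shortest_odd_ear A B p \<longleftrightarrow> odd_ear A B p \<and> (\<forall>q. odd_ear A B q \<longrightarrow> length p \<le> length q)"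

lemma shortest_odd_ear_rev: "shortest_odd_ear A B p \<Longrightarrow> shortest_odd_ear A B (rev p)"
  unfolding shortest_odd_ear_def length_rev using odd_ear_rev[of A B p] by blast

lemma path_shortcut:
  assumes "path p" "i < j" "j < length p" "adj (p ! i) (p ! j)"
  shows "path (take (Suc i) p @ drop j p)"
  unfolding path_append
proof (intro conjI disjI2)
  have "distinct p" using assms by (simp add: path_def)
  then show "set (take (Suc i) p) \<inter> set (drop j p) = {}"
    using assms by (intro set_take_disj_set_drop_if_distinct) auto
  show "adj (last (take (Suc i) p)) (hd (drop j p))"
    using assms by (simp add: take_Suc_conv_app_nth hd_drop_conv_nth)
qed (rule path_take[OF assms(1)] path_drop[OF assms(1)])+

text \<open>Replacing an odd number \<open>j - i\<close> of edges by one chord keeps the parity and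
  the ends, so the result is an odd ear, and a shorter one unless \<open>j - i = 1\<close>.\<close>

lemma shortest_odd_ear_chord:
  assumes sh: "shortest_odd_ear A B p" and "i < j" "j < length p" "odd (j - i)" "adj (p ! i) (p ! j)"
  shows "j = Suc i"
proof (rule ccontr)
  assume "j \<noteq> Suc i"
  let ?q = "take (Suc i) p @ drop j p"
  have ear: "odd_ear A B p" using sh by (simp add: shortest_odd_ear_def)
  have len: "length ?q = Suc i + (length p - j)" using assms by simp
  have hl: "hd ?q = hd p" "last ?q = last p" using assms by (auto simp: hd_append)
  have par: "even (length ?q) \<longleftrightarrow> even (length p)"
  proof -
    have "length p = (j - i) + (i + (length p - j))" using assms by simp
    then have "even (length p) \<longleftrightarrow> \<not> even (i + (length p - j))" using assms(4) by (metis even_add)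
    then show ?thesis unfolding len by simp
  qed
  have "path ?q" using path_shortcut[of p i j] ear assms by (simp add: odd_ear_def)
  moreover have "set ?q \<subseteq> set p" using set_take_subset set_drop_subset by fastforce
  moreover have "2 \<le> length ?q" using assms by simp
  ultimately have "odd_ear A B ?q" using ear unfolding odd_ear_alt hl par by blast
  then have "length p \<le> length ?q" using sh unfolding shortest_odd_ear_def by blast
  then show False unfolding len using assms(2,3) \<open>j \<noteq> Suc i\<close> by linarith
qed

text \<open>The two chords replace the first \<open>i + 2\<close> edges of the ear by two. Since
  \<open>i\<close> is even and positive, the parity is kept and the ear gets shorter.\<close>

lemma shortest_odd_ear_two_chords:
  assumes sh: "shortest_odd_ear A B p" and i: "2 \<le> i" "even i" "i + 2 < length p"
    and "adj (p ! 0) (p ! i)" "adj (p ! i) (p ! (i + 2))"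
  shows False
proof -
  have ear: "odd_ear A B p" using sh by (simp add: shortest_odd_ear_def)
  let ?d = "drop (i + 2) p"
  let ?q = "p ! 0 # p ! i # ?d"
  have p: "path p" "distinct p" "set p \<subseteq> V" using ear by (auto simp: odd_ear_def path_def)
  have hd_p: "hd p = p ! 0" using i by (intro hd_conv_nth) auto
  have "set (take (Suc i) p) \<inter> set ?d = {}"
    using p by (intro set_take_disj_set_drop_if_distinct) auto
  moreover have "p ! i \<in> set (take (Suc i) p)" "p ! 0 \<in> set (take (Suc i) p)"
    using i by (auto simp: in_set_conv_nth intro: exI[of _ i] exI[of _ 0])
  ultimately have nin: "p ! i \<notin> set ?d" "p ! 0 \<notin> set ?d" by blast+
  have "p ! 0 \<noteq> p ! i" using assms(5) adj_irrefl by metis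
  moreover have mem: "p ! 0 \<in> set p" "p ! i \<in> set p" using i by (auto intro!: nth_mem)
  ultimately have "path ?q"
    using nin assms(5,6) p(3) i(3) path_drop[OF p(1), of "i + 2"] by (simp add: path_Cons hd_drop_conv_nth subset_iff)
  moreover have hl: "hd ?q = hd p" "last ?q = last p" "length ?q = length p - i"
    using i hd_p by auto
  moreover have "set ?q \<subseteq> set p" using mem set_drop_subset[of "i + 2" p] by auto
  moreover have par: "even (length p - i) \<longleftrightarrow> even (length p)" using i by simp
  moreover have "2 \<le> length p - i" using i by simp
  ultimately have "odd_ear A B ?q" using ear unfolding odd_ear_alt hl par by blast
  then have "length p \<le> length ?q" using sh unfolding shortest_odd_ear_def by blast
  then show False using i hl by simp
qed

lemma odd_ear_new_end:
  assumes ear: "odd_ear A B p" and i: "0 < i" "Suc i < length p" and w: "w \<in> A \<union> B" "adj (p ! i) w" "w \<noteq> hd p"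
    and par: "(hd p \<in> A \<longleftrightarrow> w \<in> A) \<longleftrightarrow> even i"
  shows "odd_ear A B (take (Suc i) p @ [w])"
  unfolding odd_ear_alt
proof (intro conjI)
  have p: "path p" "distinct p" "hd p \<in> A \<union> B"
    "\<forall>z\<in>set p. z \<in> A \<union> B \<longrightarrow> z = hd p \<or> z = last p"
    using ear by (auto simp: odd_ear_alt path_def)
  have ne: "p \<noteq> []" using i by auto
  have last: "last p \<notin> set (take (Suc i) p)"
  proof -
    have "last p \<in> set (drop (Suc i) p)" using i by (metis last_drop last_in_set drop_eq_Nil2 not_le)
    moreover have "set (take (Suc i) p) \<inter> set (drop (Suc i) p) = {}"
      using p by (intro set_take_disj_set_drop_if_distinct) auto
    ultimately show ?thesis by blast
  qed
  have sub: "z = hd p" if "z \<in> set (take (Suc i) p)" "z \<in> A \<union> B" for z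
    using p(4) that last set_take_subset by (metis subsetD)
  have "w \<notin> set (take (Suc i) p)" using sub w by blast
  then show "path (take (Suc i) p @ [w])"
    unfolding path_append
  proof (intro conjI disjI2)
    show "path [w]" using adj_V2[OF w(2)] by (simp add: path_def)
    show "adj (last (take (Suc i) p)) (hd [w])" using i w by (simp add: take_Suc_conv_app_nth)
    show "path (take (Suc i) p)" by (rule path_take[OF p(1)])
    show "set (take (Suc i) p) \<inter> set [w] = {}" using \<open>w \<notin> set (take (Suc i) p)\<close> by simp
  qed
  show hd: "hd (take (Suc i) p @ [w]) \<in> A \<union> B" using p ne by (simp add: hd_append)
  show "2 \<le> length (take (Suc i) p @ [w])" using i by simp
  show "last (take (Suc i) p @ [w]) \<in> A \<union> B" using w by simp
  show "\<forall>z\<in>set (take (Suc i) p @ [w]). z \<in> A \<union> B \<longrightarrow> z = hd (take (Suc i) p @ [w]) \<or> z = last (take (Suc i) p @ [w])"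
    using sub ne by (auto simp: hd_append)
  show "(hd (take (Suc i) p @ [w]) \<in> A \<longleftrightarrow> last (take (Suc i) p @ [w]) \<in> A) \<longleftrightarrow> even (length (take (Suc i) p @ [w]))"
    using par i ne by (simp add: hd_append)
qed

text \<open>With the wrong class of \<open>w\<close>, the first \<open>i + 1\<close> vertices
  followed by \<open>w\<close> would form an odd ear with only \<open>i + 2\<close>
  vertices.\<close>

lemma shortest_odd_ear_nb_class:
  assumes sh: "shortest_odd_ear A B p" and i: "0 < i" "i + 2 < length p" and w: "w \<in> A \<union> B" "adj (p ! i) w" "w \<noteq> hd p"
  shows "(hd p \<in> A \<longleftrightarrow> w \<in> A) \<longleftrightarrow> odd i"
proof (rule ccontr)
  assume neg: "\<not> ?thesis"
  have 1: "odd_ear A B p" using sh by (simp add: shortest_odd_ear_def)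
  have par: "(hd p \<in> A \<longleftrightarrow> w \<in> A) \<longleftrightarrow> even i" using neg by blast
  have lt: "Suc i < length p" using i by simp
  from odd_ear_new_end[OF 1 i(1) lt w par]
  have "length p \<le> length (take (Suc i) p @ [w])" using sh unfolding shortest_odd_ear_def by blast
  then show False using i by simp
qed

lemma shortest_odd_earD: "shortest_odd_ear A B p \<Longrightarrow> odd_ear A B p"
  by (simp add: shortest_odd_ear_def)

lemma shortest_odd_ear_le: "shortest_odd_ear A B p \<Longrightarrow> odd_ear A B q \<Longrightarrow> length p \<le> length q"
  by (simp add: shortest_odd_ear_def)

lemma odd_ear_interior:
  assumes ear: "odd_ear A B p" and i: "0 < i" "Suc i < length p"
  shows "p ! i \<notin> A \<union> B"
proof
  assume "p ! i \<in> A \<union> B"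
  moreover have d: "distinct p" and ne: "p \<noteq> []"
    and "\<forall>z\<in>set p. z \<in> A \<union> B \<longrightarrow> z = hd p \<or> z = last p"
    using ear i by (auto simp: odd_ear_alt path_def)
  moreover have "p ! i \<in> set p" using i by simp
  ultimately have "p ! i = p ! 0 \<or> p ! i = p ! (length p - 1)"
    by (fastforce simp: hd_conv_nth last_conv_nth)
  then show False using nth_eq_iff_index_eq[OF d] i ne by auto
qed

text \<open>For a core neighbour \<open>w\<close> other than the ends,
  \<open>shortest_odd_ear_nb_class\<close> applies from both ends and fixes the class of
  \<open>w\<close> relative to each. Together the two statements say that the ear has the bipartite
  parity, which it has not. If \<open>w\<close> is an end, an odd distance along the ear is excluded
  by the chord lemma.\<close>

lemma shortest_odd_ear_nb_mid:
  assumes sh: "shortest_odd_ear A B p" and i: "2 \<le> i" "i + 2 < length p" and w: "w \<in> A \<union> B" "adj (p ! i) w"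
  shows "w = hd p \<and> even i \<or> w = last p \<and> even (length p - 1 - i)"
proof -
  have ne: "p \<noteq> []" using i by auto
  have hl: "hd p = p ! 0" "last p = p ! (length p - 1)" using ne by (simp_all add: hd_conv_nth last_conv_nth)
  define j where "j = length p - 1 - i"
  have j: "i + j = length p - 1" "0 < j" "j + 2 < length p" using i by (auto simp: j_def)
  consider "w = hd p" | "w = last p" | "w \<noteq> hd p" "w \<noteq> last p" by blast
  then show ?thesis
  proof cases
    case 1
    have "even i"
    proof (rule ccontr)
      assume "odd i"
      then have "i = Suc 0"
        using shortest_odd_ear_chord[OF sh, of 0 i] i w 1 hl adj_sym by simp
      then show False using i by simp
    qed
    then show ?thesis using 1 by blast
  next
    case 2
    have "even j"
    proof (rule ccontr)
      assume "odd j"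
      then have odd: "odd (length p - 1 - i)" by (simp add: j_def)
      have "adj (p ! i) (p ! (length p - 1))" using w(2) 2 hl(2) by argo
      moreover have "i < length p - 1" "length p - 1 < length p" using i by linarith+
      ultimately have "length p - 1 = Suc i" using shortest_odd_ear_chord[OF sh _ _ odd] by blast
      then show False using i by simp
    qed
    then show ?thesis using 2 by (simp add: j_def)
  next
    case 3
    have "0 < i" using i by simp
    from shortest_odd_ear_nb_class[OF sh this i(2) w 3(1)]
    have "(hd p \<in> A \<longleftrightarrow> w \<in> A) \<longleftrightarrow> odd i" .
    moreover have rev: "rev p ! j = p ! i" using i j by (simp add: rev_nth j_def)
    have "j + 2 < length (rev p)" "adj (rev p ! j) w" "w \<noteq> hd (rev p)"
      using j w 3 rev by (simp_all add: hd_rev)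
    from shortest_odd_ear_nb_class[OF shortest_odd_ear_rev[OF sh] j(2) this(1) w(1) this(2,3)]
    have "(last p \<in> A \<longleftrightarrow> w \<in> A) \<longleftrightarrow> odd j" by (simp add: hd_rev)
    moreover have "(hd p \<in> A \<longleftrightarrow> last p \<in> A) \<longleftrightarrow> even (length p)"
      using shortest_odd_earD[OF sh] by (simp add: odd_ear_def)
    moreover have "length p = Suc (i + j)" using j(1) i by simp
    then have "even (length p) \<longleftrightarrow> odd (i + j)" by simp
    ultimately show ?thesis unfolding even_add by blast
  qed
qed

text \<open>If both ends were neighbours, both distances along the ear would be even. The ends of
  the odd ear would then lie in different classes, and the two ends with \<open>p ! i\<close>
  between them would be an odd ear on three vertices.\<close>

lemma shortest_odd_ear_card_nb_mid:
  assumes sh: "shortest_odd_ear A B p" and i: "2 \<le> i" "i + 2 < length p"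
  shows "card (nb (A \<union> B) (p ! i)) \<le> 1"
proof -
  have sub: "nb (A \<union> B) (p ! i) \<subseteq> {hd p, last p}"
    using shortest_odd_ear_nb_mid[OF sh i] by (auto simp: nb_def)
  have "\<not> (adj (p ! i) (hd p) \<and> adj (p ! i) (last p))"
  proof
    assume adj: "adj (p ! i) (hd p) \<and> adj (p ! i) (last p)"
    note ear = shortest_odd_earD[OF sh]
    have ends: "hd p \<in> A \<union> B" "last p \<in> A \<union> B" "distinct p"
      using ear by (auto simp: odd_ear_def path_def)
    have ne: "p \<noteq> []" using i by auto
    have hl: "hd p \<noteq> last p"
      using ends(3) i ne nth_eq_iff_index_eq[OF ends(3), of 0 "length p - 1"] by (simp add: hd_conv_nth last_conv_nth)
    have out: "p ! i \<notin> A \<union> B" using odd_ear_interior[OF ear, of i] i by simp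
    have nhl: "p ! i \<noteq> hd p" "p ! i \<noteq> last p" using out ends by metis+
    have "even i" "even (length p - 1 - i)"
      using shortest_odd_ear_nb_mid[OF sh i, of "hd p"] shortest_odd_ear_nb_mid[OF sh i, of "last p"] adj ends hl by auto
    moreover have "length p = i + (length p - 1 - i) + 1" using i by simp
    ultimately have "odd (length p)" by (metis even_add odd_one)
    then have par: "\<not> (hd p \<in> A \<longleftrightarrow> last p \<in> A)" using ear by (simp add: odd_ear_def)
    have "path [hd p, p ! i, last p]"
      using adj hl nhl adj_sym[of "p ! i" "hd p"] adj_V2[of "p ! i"] adj_V[of "p ! i" "hd p"]
      by (simp add: path_def)
    then have "odd_ear A B [hd p, p ! i, last p]"
      using par ends out by (simp add: odd_ear_def)
    then show False using shortest_odd_ear_le[OF sh] i by fastforce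
  qed
  then have "nb (A \<union> B) (p ! i) \<subseteq> {hd p} \<or> nb (A \<union> B) (p ! i) \<subseteq> {last p}"
    using sub by (auto simp: nb_def)
  then show ?thesis
    using card_mono[of "{hd p}" "nb (A \<union> B) (p ! i)"] card_mono[of "{last p}" "nb (A \<union> B) (p ! i)"] by auto
qed

lemma nonadjacent_bound:
  assumes "finite A" "finite B" "N \<subseteq> A" "N' \<subseteq> B" "\<And>x y. x \<in> N \<Longrightarrow> y \<in> N' \<Longrightarrow> \<not> adj x y"
  shows "dn A B + card N * card N' \<le> card A * card B"
proof -
  let ?E = "{(x, y). x \<in> A \<and> y \<in> B \<and> adj x y}"
  have fin: "finite ?E" "finite (N \<times> N')"
    using assms finite_subset[of ?E "A \<times> B"] finite_subset[of "N \<times> N'" "A \<times> B"] by auto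
  have "dn A B + card N * card N' = card ?E + card (N \<times> N')"
    by (simp add: dn_eq_card[OF assms(1)] card_cartesian_product)
  also have "\<dots> = card (?E \<union> N \<times> N')" using fin assms(5) by (intro card_Un_disjoint[symmetric]) auto
  also have "\<dots> \<le> card (A \<times> B)" using assms by (intro card_mono) auto
  finally show ?thesis by (simp add: card_cartesian_product)
qed

lemma dn_split_low_degree:
  assumes "S \<subseteq> V" "\<And>v. v \<in> V - S \<Longrightarrow> 12 * card (nb V v) \<le> 5 * n"
  shows "6 * dn V V \<le> 6 * dn S S + 5 * (n * card (V - S))"
proof -
  let ?W = "V - S"
  have fin: "finite S" "finite ?W" using assms finite_V finite_subset by auto
  have V: "S \<union> ?W = V" "S \<inter> ?W = {}" using assms by auto
  have "dn V V = dn S S + 2 * dn S ?W + dn ?W ?W"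
    using dn_Un_self[OF fin V(2)] unfolding V(1) .
  moreover have "dn ?W V = dn ?W S + dn ?W ?W" using dn_Un_right[OF V(2), of ?W] unfolding V(1) .
  moreover have "dn ?W S = dn S ?W" by (rule dn_commute[OF fin(2,1)])
  moreover have "12 * dn ?W V \<le> card ?W * (5 * n)"
    unfolding dn_def sum_distrib_left using sum_bounded_above[of ?W "\<lambda>v. 12 * card (nb V v)" "5 * n"] assms(2)
    by simp
  moreover have "card ?W * (5 * n) = 5 * (n * card ?W)" by simp
  ultimately show ?thesis by linarith
qed

end

subsection \<open>Counting edges when there is an odd ear\<close>

context fgraph
begin

text \<open>Every interior vertex \<open>p ! i\<close> with a neighbour at an end of the ear rules out the chord
  between \<open>p ! i\<close> and the vertex two steps away from that end; the pair \<open>(1, 4)\<close> is never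
  an edge either, and this makes the inequality sharp enough.\<close>

lemma shortest_odd_ear_chord_count:
  assumes sh: "shortest_odd_ear A B p" and len: "length p = 2 * k + 2" and k: "2 \<le> k"
    and Z: "Z = (!) p ` {1..2 * k}"
  shows "dn Z Z + 2 * (\<Sum>i\<in>{2..2 * k - 1}. card (nb (A \<union> B) (p ! i))) + 2 \<le> 2 * k * (2 * k - 1)"
proof -
  let ?I = "{1..2 * k}"
  let ?C = "A \<union> B"
  let ?R = "\<lambda>i j. adj (p ! i) (p ! j)"
  let ?E = "{(i, j). i \<in> ?I \<and> j \<in> ?I \<and> i < j \<and> ?R i j}"
  let ?U = "{(i, j). i \<in> ?I \<and> j \<in> ?I \<and> i < j \<and> i \<noteq> j}"
  note ear = shortest_odd_earD[OF sh]
  have dist: "distinct p" using ear by (simp add: odd_ear_def path_def)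
  have inj: "inj_on ((!) p) ?I" by (rule inj_on_nth[OF dist]) (simp add: len)
  have "dn Z Z = (\<Sum>i\<in>?I. card (nb Z (p ! i)))"
    unfolding dn_def using sum.reindex[OF inj, of "\<lambda>z. card (nb Z z)", folded Z] by simp
  also have "\<dots> = (\<Sum>i\<in>?I. card {j \<in> ?I. ?R i j})"
  proof (rule sum.cong)
    fix i
    have "nb Z (p ! i) = (!) p ` {j \<in> ?I. ?R i j}" by (auto simp: nb_def Z)
    moreover have "inj_on ((!) p) {j \<in> ?I. ?R i j}" by (rule inj_on_subset[OF inj]) auto
    ultimately show "card (nb Z (p ! i)) = card {j \<in> ?I. ?R i j}" by (simp add: card_image)
  qed simp
  also have "\<dots> = card (SIGMA i:?I. {j \<in> ?I. ?R i j})" by simp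
  also have "(SIGMA i:?I. {j \<in> ?I. ?R i j}) = {(i, j). i \<in> ?I \<and> j \<in> ?I \<and> ?R i j}" by auto
  also have "card \<dots> = 2 * card ?E"
    by (rule card_sym_pairs) (simp_all add: adj_commute adj_irrefl)
  finally have dnZ: "dn Z Z = 2 * card ?E" .
  have "2 * card ?U = card {(i, j). i \<in> ?I \<and> j \<in> ?I \<and> i \<noteq> j}"
    by (rule card_sym_pairs[symmetric]) auto
  also have "{(i, j). i \<in> ?I \<and> j \<in> ?I \<and> i \<noteq> j} = (SIGMA i:?I. ?I - {i})" by auto
  also have "card \<dots> = (\<Sum>i\<in>?I. card (?I - {i}))" by simp
  also have "\<dots> = (\<Sum>i\<in>?I. 2 * k - 1)" by (rule sum.cong) auto
  finally have cU: "2 * card ?U = 2 * k * (2 * k - 1)" by simp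
  \<comment> \<open>By \<open>shortest_odd_ear_card_nb_mid\<close>, the sum over the middle vertices
    is at most the number of indices in \<open>J\<close>; each of them is now charged to a non-edge
    of the ear.\<close>
  define J where "J = {i \<in> {2..2 * k - 1}. nb ?C (p ! i) \<noteq> {}}"
  have "(\<Sum>i\<in>{2..2 * k - 1}. card (nb ?C (p ! i))) \<le> (\<Sum>i\<in>{2..2 * k - 1}. if nb ?C (p ! i) \<noteq> {} then 1 else 0)"
  proof (rule sum_mono)
    fix i assume "i \<in> {2..2 * k - 1}"
    then have "2 \<le> i" "i + 2 < length p" using k len by auto
    then show "card (nb ?C (p ! i)) \<le> (if nb ?C (p ! i) \<noteq> {} then 1 else 0)"
      using shortest_odd_ear_card_nb_mid[OF sh, of i] by auto
  qed
  also have "\<dots> = (\<Sum>i\<in>J. 1)" unfolding J_def by (rule sum.inter_filter[symmetric]) simp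
  finally have mid: "(\<Sum>i\<in>{2..2 * k - 1}. card (nb ?C (p ! i))) \<le> card J" by simp
  define f where "f i = (if even i then (i, i + 2) else (i - 2, i))" for i :: nat
  have "inj_on f J"
  proof (rule inj_onI)
    fix i j assume ij: "i \<in> J" "j \<in> J" and eq: "f i = f j"
    then have "2 \<le> i" "2 \<le> j" by (auto simp: J_def)
    then show "i = j" using eq by (cases "even i"; cases "even j") (auto simp: f_def)
  qed
  then have cJ: "card (f ` J) = card J" by (rule card_image)
  have ne: "p \<noteq> []" using len by auto
  have fJ: "f i \<in> ?U - ?E \<and> f i \<noteq> (1, 4)" if "i \<in> J" for i
  proof -
    obtain w where i: "2 \<le> i" "i \<le> 2 * k - 1" and w: "w \<in> ?C" "adj (p ! i) w"
      using \<open>i \<in> J\<close> unfolding J_def nb_def by auto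
    have i2: "i + 2 < length p" using i k len by linarith
    note N = shortest_odd_ear_nb_mid[OF sh i(1) i2 w]
    show ?thesis
    proof (cases "even i")
      case True
      then have le: "i + 2 \<le> 2 * k" using i k by presburger
      then have "length p - 1 - i = 2 * k - i + 1" using len by simp
      then have "odd (length p - 1 - i)" using True by simp
      then have "w = hd p" using N by blast
      then have "adj (p ! 0) (p ! i)" using adj_sym[OF w(2)] ne by (simp add: hd_conv_nth)
      then have "\<not> ?R i (i + 2)" using shortest_odd_ear_two_chords[OF sh i(1) True i2] by blast
      then show ?thesis using True i le by (auto simp: f_def)
    next
      case False
      then have "w = last p" using N by blast
      \<comment> \<open>\<open>j\<close> is the position of \<open>p ! i\<close> in the reversed
        ear. It is even, so the argument of the other case applies there.\<close>
      define j where "j = 2 * k + 1 - i"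
      have j: "2 \<le> j" "j + 2 < length (rev p)" "even j" "i + j = 2 * k + 1"
        using False i len k by (auto simp: j_def)
      have i3: "3 \<le> i" using False i by presburger
      have nth: "rev p ! 0 = last p" "rev p ! j = p ! i" "rev p ! (j + 2) = p ! (i - 2)"
      proof -
        have "length p - Suc j = i" "length p - Suc (j + 2) = i - 2" using j len i3 by linarith+
        then show "rev p ! 0 = last p" "rev p ! j = p ! i" "rev p ! (j + 2) = p ! (i - 2)"
          using j len ne by (simp_all add: rev_nth last_conv_nth)
      qed
      have "adj (rev p ! 0) (rev p ! j)" using nth adj_sym[OF w(2)] \<open>w = last p\<close> by simp
      then have "\<not> adj (rev p ! j) (rev p ! (j + 2))"
        using shortest_odd_ear_two_chords[OF shortest_odd_ear_rev[OF sh] j(1,3,2)] by blast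
      then have "\<not> ?R (i - 2) i" using nth adj_sym by metis
      then show ?thesis using False i i3 by (auto simp: f_def)
    qed
  qed
  \<comment> \<open>The distance 3 is odd, so this chord would shorten the ear. The pairs
    \<open>f i\<close> have distance 2, so this is a further non-edge.\<close>
  have "\<not> ?R 1 4"
    using shortest_odd_ear_chord[OF sh, of 1 4] len k by auto
  then have "(1, 4) \<notin> ?E" by simp
  moreover have "(1, 4) \<notin> f ` J" using fJ unfolding image_iff by metis
  moreover have "(1, 4) \<in> ?U" using k by simp
  ultimately have 14: "(1, 4) \<in> ?U" "(1, 4) \<notin> ?E \<union> f ` J" by blast+
  have finU: "finite ?U" by (rule finite_subset[of _ "?I \<times> ?I"]) auto
  have subE: "?E \<subseteq> ?U" by auto
  have subJ: "f ` J \<subseteq> ?U" by (rule image_subsetI) (rule DiffD1[OF conjunct1[OF fJ]])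
  have fin: "finite ?E" "finite (f ` J)"
    by (rule finite_subset[OF subE finU], rule finite_subset[OF subJ finU])
  have "card ?E + card J + 1 = card (insert (1, 4) (?E \<union> f ` J))"
  proof -
    have "f i \<notin> ?E" if "i \<in> J" for i using conjunct1[OF fJ[OF that]] unfolding Diff_iff by (rule conjunct2)
    moreover have "E \<inter> f ` J = {}" if "\<And>i. i \<in> J \<Longrightarrow> f i \<notin> E" for E using that by blast
    ultimately have "?E \<inter> f ` J = {}" by presburger
    then have "card (?E \<union> f ` J) = card ?E + card J" unfolding cJ[symmetric] by (rule card_Un_disjoint[OF fin])
    moreover have "card (insert (1, 4) (?E \<union> f ` J)) = Suc (card (?E \<union> f ` J))"
      by (rule card_insert_disjoint[OF finite_UnI[OF fin] 14(2)])
    ultimately show ?thesis by linarith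
  qed
  also have "\<dots> \<le> card ?U" by (intro card_mono finU insert_subsetI Un_least subE subJ 14(1))
  finally show ?thesis using dnZ cU mid by linarith
qed

lemma shortest_odd_ear_nb_first:
  assumes sh: "shortest_odd_ear A B p" and "4 \<le> length p" "w \<in> A \<union> B" "adj (p ! 1) w"
  shows "w \<in> A \<longleftrightarrow> hd p \<in> A"
proof (cases "w = hd p")
  case False
  have "(hd p \<in> A \<longleftrightarrow> w \<in> A) \<longleftrightarrow> odd (1 :: nat)"
    by (rule shortest_odd_ear_nb_class[OF sh]) (use assms False in auto)
  then show ?thesis by simp
qed simp

text \<open>The right side is twice the number of edges of \<open>H(n, 2 * k - 2)\<close>. Only the
  two outermost interior vertices can have more than one neighbour in the core, so everything
  depends on \<open>c 1 + c r\<close>. It is controlled in three ways, according to the number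
  \<open>r\<close> of interior vertices.\<close>

lemma shortest_odd_ear_bound:
  assumes AB: "A \<union> B \<subseteq> V" "A \<inter> B = {}" and lk: "linked k A B" and free: "avoids_cycle (2 * k + 1)"
    and k: "2 \<le> k" and n: "card V = n" "252 * k \<le> n" and Q: "8 * card (V - (A \<union> B)) \<le> n"
    and deg: "\<And>v. v \<in> V - (A \<union> B) \<Longrightarrow> 12 * card (nb V v) \<le> 5 * n"
    and sh: "shortest_odd_ear A B p" and hd: "hd p \<in> A"
  shows "dn V V < 2 * ((n + 1 - 2 * k)\<^sup>2 div 4 + (2 * k choose 2))"
proof -
  note ear = shortest_odd_earD[OF sh]
  have L: "2 * k + 1 \<le> length p" by (rule length_odd_ear[OF free lk ear])
  let ?C = "A \<union> B"
  obtain x m y where p: "p = x # m @ [y]" "path (x # m @ [y])" "x \<in> A \<union> B" "y \<in> A \<union> B"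
    "set m \<inter> (A \<union> B) = {}" "(x \<in> A \<longleftrightarrow> y \<in> A) \<longleftrightarrow> even (length m)"
    using ear unfolding odd_ear_conv by blast
  have xA: "x \<in> A" using hd p(1) by simp
  define r where "r = length m"
  have r: "length p = r + 2" "2 * k - 1 \<le> r" "3 \<le> r" using p(1) L k by (auto simp: r_def)
  have m: "m \<noteq> []" "p ! 1 = hd m" "p ! r = last m" "path m" "adj x (hd m)" "adj (last m) y"
  proof -
    show "m \<noteq> []" using r by (auto simp: r_def)
    then show "p ! 1 = hd m" "p ! r = last m"
      using r(3) by (auto simp: p(1) nth_append hd_conv_nth last_conv_nth r_def nth_Cons' )
    show "path m" "adj x (hd m)" "adj (last m) y"
      using p(2) \<open>m \<noteq> []\<close> by (auto simp: path_Cons path_append)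
  qed
  define Z where "Z = (!) p ` {1..r}"
  have dist: "distinct p" using ear by (simp add: odd_ear_def path_def)
  have inj: "inj_on ((!) p) {1..r}" by (rule inj_on_nth[OF dist]) (auto simp: r(1))
  have cZ: "card Z = r" unfolding Z_def card_image[OF inj] by simp
  have "Z \<subseteq> set p" using r by (auto simp: Z_def)
  then have ZV: "Z \<subseteq> V" using ear by (auto simp: odd_ear_def path_def)
  have ZC: "?C \<inter> Z = {}" using odd_ear_interior[OF ear] r by (auto simp: Z_def)
  have fin: "finite A" "finite B" "finite ?C" "finite Z"
    using AB ZV finite_V finite_subset by (auto intro: finite_subset)
  let ?S = "?C \<union> Z"
  define w where "w = card (V - ?S)"
  have "V - ?C = Z \<union> (V - ?S)" using ZC ZV by blast
  moreover have "card (Z \<union> (V - ?S)) = r + w"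
    using card_Un_disjoint[of Z "V - ?S"] fin(4) finite_V cZ unfolding w_def by blast
  ultimately have rw: "card (V - ?C) = r + w" by simp
  have "card V = card ?C + card (V - ?C)"
    using AB(1) finite_V by (metis card_Diff_subset card_mono fin(3) le_add_diff_inverse)
  then have nsum: "n = card A + card B + r + w"
    using rw n card_Un_disjoint[OF fin(1,2) AB(2)] by simp
  have D: "6 * dn V V \<le> 6 * dn ?S ?S + 5 * (n * w)"
    unfolding w_def using AB ZV deg by (intro dn_split_low_degree) auto
  have noE: "dn A A = 0" "dn B B = 0"
  proof -
    have "\<not> adj u v" if "u \<in> A \<and> v \<in> A \<or> u \<in> B \<and> v \<in> B" for u v
    proof
      assume "adj u v"
      then have "path [u, v]" using adj_irrefl adj_V adj_V2 by (auto simp: path_def)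
      then have "odd_ear A B [u, v]" using that AB(2) by (auto simp: odd_ear_def)
      from length_odd_ear[OF free lk this] k show False by simp
    qed
    then have "\<And>u. u \<in> A \<Longrightarrow> nb A u = {}" "\<And>u. u \<in> B \<Longrightarrow> nb B u = {}" by (auto simp: nb_def)
    then show "dn A A = 0" "dn B B = 0" by (auto simp: dn_def)
  qed
  define c where "c i = card (nb ?C (p ! i))" for i
  define mid where "mid = (\<Sum>i\<in>{2..r - 1}. c i)"
  have "dn Z ?C = (\<Sum>i\<in>{1..r}. c i)"
    unfolding dn_def c_def using sum.reindex[OF inj, of "\<lambda>z. card (nb ?C z)", folded Z_def] by simp
  also have "{1..r} = insert 1 (insert r {2..r - 1})" using r by auto
  also have "(\<Sum>i\<in>\<dots>. c i) = c 1 + c r + mid" using r by (simp add: mid_def)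
  finally have dZC: "dn Z ?C = c 1 + c r + mid" .
  have "dn ?S ?S = dn ?C ?C + 2 * dn Z ?C + dn Z Z"
    using dn_Un_self[OF fin(3,4) ZC] dn_commute[OF fin(3,4)] by simp
  also have "dn ?C ?C = 2 * dn A B" using dn_Un_self[OF fin(1,2) AB(2)] noE by simp
  finally have T: "dn ?S ?S = 2 * dn A B + 2 * c 1 + 2 * c r + 2 * mid + dn Z Z"
    unfolding dZC by (simp only: distrib_left add.assoc)
  have "mid \<le> (\<Sum>i\<in>{2..r - 1}. 1)"
    unfolding mid_def c_def
  proof (rule sum_mono)
    fix i assume "i \<in> {2..r - 1}"
    then show "card (nb ?C (p ! i)) \<le> 1"
      using r by (intro shortest_odd_ear_card_nb_mid[OF sh]) auto
  qed
  then have mid: "mid \<le> r - 2" by simp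
  have dZ: "dn Z Z \<le> r * (r - 1)" using dn_self_le[OF fin(4)] cZ by simp
  have N1: "nb ?C (p ! 1) \<subseteq> A"
    using shortest_odd_ear_nb_first[OF sh] r hd by (auto simp: nb_def)
  have rr: "rev p ! 1 = p ! r" using r by (simp add: rev_nth)
  have N2: "w \<in> A \<longleftrightarrow> y \<in> A" if "w \<in> nb ?C (p ! r)" for w
    using shortest_odd_ear_nb_first[OF shortest_odd_ear_rev[OF sh], of w] r that p(1) rr
    by (simp add: nb_def)
  have c1: "1 \<le> c 1" "1 \<le> c r"
  proof -
    have "x \<in> nb ?C (p ! 1)" "y \<in> nb ?C (p ! r)" using m p adj_sym[OF m(5)] by (auto simp: nb_def)
    then have "nb ?C (p ! 1) \<noteq> {}" "nb ?C (p ! r) \<noteq> {}" by blast+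
    then show "1 \<le> c 1" "1 \<le> c r" unfolding c_def by (simp_all add: Suc_le_eq card_gt_0_iff)
  qed
  have nz: "p ! 1 \<in> V - ?C" "p ! r \<in> V - ?C" using ZC ZV r by (auto simp: Z_def)
  consider "r = 2 * k - 1" | "r = 2 * k" | "2 * k + 1 \<le> r" using r by linarith
  then show ?thesis
  proof cases
    \<comment> \<open>The outermost interior vertices see different classes. An edge between their
      neighbourhoods would close a cycle of length \<open>2 * k + 1\<close> with the interior, so
      \<open>c 1 * c r\<close> pairs between \<open>A\<close> and \<open>B\<close> are
      missing.\<close>
    case 1
    then have "odd r" using k by presburger
    then have "y \<notin> A" using p(6) xA unfolding r_def by blast
    then have N2B: "nb ?C (p ! r) \<subseteq> B" using N2 nb_subset[of ?C "p ! r"] by blast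
    have "dn A B + c 1 * c r \<le> card A * card B"
      unfolding c_def
    proof (rule nonadjacent_bound[OF fin(1,2) N1 N2B])
      fix u v assume u: "u \<in> nb ?C (p ! 1)" and v: "v \<in> nb ?C (p ! r)"
      show "\<not> adj u v"
      proof
        assume "adj u v"
        then have "u \<noteq> v" "u \<in> V" "v \<in> V" using adj_irrefl adj_V adj_V2 by blast+
        moreover have "u \<notin> set m" "v \<notin> set m" "adj u (hd m)" "adj (last m) v"
          using u v m(2,3) p(5) adj_sym[of "p ! 1" u] by (auto simp: nb_def)
        ultimately have "path (u # m @ [v])"
          using m(1,4) by (simp add: path_Cons path_append path_def[of "[v]"] path_def[of "[]"])
        moreover have "length (u # m @ [v]) = 2 * k + 1" using 1 k by (simp add: r_def)
        moreover have "adj (last (u # m @ [v])) (hd (u # m @ [v]))" using adj_sym[OF \<open>adj u v\<close>] by simp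
        ultimately show False using free unfolding avoids_cycle_def by blast
      qed
    qed
    \<comment> \<open>The difference of the two sides is
      \<open>(c 1 - 1) * (c r - 1)\<close>.\<close>
    moreover have "c 1 + c r \<le> c 1 * c r + 1"
    proof -
      obtain a b where "c 1 = Suc a" "c r = Suc b" using c1 by (metis Suc_le_D One_nat_def)
      then show ?thesis by simp
    qed
    moreover have "2 * (r - 2) + r * (r - 1) + 4 = 2 * k * (2 * k - 1)"
    proof -
      obtain j where "k = Suc j" using k by (cases k) auto
      moreover from this k obtain i where "j = Suc i" by (cases j) auto
      ultimately show ?thesis using 1 by (simp add: algebra_simps)
    qed
    ultimately have "dn ?S ?S + 2 \<le> 2 * (card A * card B) + 2 * k * (2 * k - 1)"
      using T mid dZ by linarith
    then show ?thesis
      using nsum 1 k n rw Q by (intro short_ear_arith[OF _ _ n(2) _ D]) auto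
  next
    \<comment> \<open>Both outermost interior vertices see \<open>A\<close>, and a common neighbour
      would close a cycle with the \<open>2 * k\<close> interior vertices. The bounds on the
      remaining pairs have no slack here, hence the finer chord count.\<close>
    case 2
    then have "even r" by simp
    then have "y \<in> A" using p(6) xA unfolding r_def by blast
    then have N2A: "nb ?C (p ! r) \<subseteq> A" using N2 nb_subset[of ?C "p ! r"] by blast
    have "nb ?C (p ! 1) \<inter> nb ?C (p ! r) = {}"
    proof (rule ccontr)
      assume "\<not> ?thesis"
      then obtain u where u: "u \<in> ?C" "adj (hd m) u" "adj (last m) u" using m by (auto simp: nb_def)
      then have "path (u # m)" using m(4) p(5) adj_sym[OF u(2)] adj_V2[OF u(2)] by (auto simp: path_Cons)
      moreover have "length (u # m) = 2 * k + 1" using 2 by (simp add: r_def)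
      moreover have "adj (last (u # m)) (hd (u # m))" using u m(1) by simp
      ultimately show False using free unfolding avoids_cycle_def by blast
    qed
    then have "c 1 + c r = card (nb ?C (p ! 1) \<union> nb ?C (p ! r))"
      unfolding c_def by (simp add: card_Un_disjoint)
    also have "\<dots> \<le> card A" using N1 N2A fin by (intro card_mono) auto
    finally have "c 1 + c r \<le> card A" .
    moreover have "dn Z Z + 2 * mid + 2 \<le> 2 * k * (2 * k - 1)"
      using shortest_odd_ear_chord_count[OF sh _ k, of Z] r(1) 2 by (simp add: mid_def c_def Z_def)
    moreover have "dn A B \<le> card A * card B" using fin by (intro dn_le)
    \<comment> \<open>Together the two outermost vertices send no more edges to the core than one
      extra vertex of \<open>B\<close> joined to all of \<open>A\<close>, so the surplus interior
      vertex is booked as such a vertex.\<close>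
    moreover have "card A * (card B + 1) = card A * card B + card A" by simp
    ultimately have "dn ?S ?S + 2 \<le> 2 * (card A * (card B + 1)) + 2 * k * (2 * k - 1)"
      using T by linarith
    then show ?thesis
      using nsum 2 k n rw Q
      by (intro short_ear_arith[OF _ _ n(2) _ D, where a = "card A" and b = "card B + 1"]) auto
  next
    \<comment> \<open>With at least two surplus interior vertices, the degree bound
      \<open>5 * n / 12\<close> for the two outermost ones suffices.\<close>
    case 3
    have "c 1 \<le> card (nb V (p ! 1))" "c r \<le> card (nb V (p ! r))"
      unfolding c_def using AB by (auto intro!: card_nb_mono)
    then have "12 * c 1 \<le> 5 * n" "12 * c r \<le> 5 * n"
      using deg[OF nz(1)] deg[OF nz(2)] by linarith+
    moreover have "dn A B \<le> card A * card B" using fin by (intro dn_le)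
    moreover have "r * (r + 1) = r * (r - 1) + 2 * r" using r by (cases r) (auto simp: algebra_simps)
    ultimately have "6 * dn ?S ?S + 24 \<le> 12 * (card A * card B) + 10 * n + 6 * (r * (r + 1))"
      using T mid dZ r by linarith
    then show ?thesis
      using nsum 3 k n rw Q
      by (intro long_ear_arith[OF _ _ n(2) k _ _ _ D, where s = "r + 1 - 2 * k" and r = r]) auto
  qed
qed

lemma no_odd_ear:
  assumes AB: "A \<union> B \<subseteq> V" "A \<inter> B = {}" and lk: "linked k A B" and free: "avoids_cycle (2 * k + 1)"
    and k: "2 \<le> k" and n: "card V = n" "252 * k \<le> n" and Q: "8 * card (V - (A \<union> B)) \<le> n"
    and deg: "\<And>v. v \<in> V - (A \<union> B) \<Longrightarrow> 12 * card (nb V v) \<le> 5 * n"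
    and e: "2 * ((n + 1 - 2 * k)\<^sup>2 div 4 + (2 * k choose 2)) \<le> dn V V"
  shows "\<not> odd_ear A B p"
proof
  assume "odd_ear A B p"
  then obtain q where q: "shortest_odd_ear A B q"
    unfolding shortest_odd_ear_def using ex_has_least_nat[of "odd_ear A B" p length] by blast
  have BA: "B \<union> A \<subseteq> V" "B \<inter> A = {}" "B \<union> A = A \<union> B" using AB by auto
  have swap: "odd_ear B A = odd_ear A B"
    using odd_ear_swap[OF AB(2)] odd_ear_swap[OF BA(2)] by (intro ext iffI)
  have "linked k B A"
    unfolding linked_def
  proof (intro ballI impI allI)
    fix u w L
    assume uw: "u \<in> B \<union> A" "w \<in> B \<union> A" "u \<noteq> w" "2 \<le> L" "L \<le> 2 * k" "even L \<longleftrightarrow> (u \<in> B \<longleftrightarrow> w \<in> B)"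
    have "even L \<longleftrightarrow> (u \<in> A \<longleftrightarrow> w \<in> A)" using uw AB(2) by blast
    then show "\<exists>q. path q \<and> set q \<subseteq> B \<union> A \<and> hd q = u \<and> last q = w \<and> length q = Suc L"
      using lk uw unfolding linked_def BA(3) by blast
  qed
  moreover have "shortest_odd_ear B A q" using q by (simp add: shortest_odd_ear_def swap)
  moreover have "hd q \<in> A \<or> hd q \<in> B" using q by (auto simp: shortest_odd_ear_def odd_ear_def)
  ultimately have "dn V V < 2 * ((n + 1 - 2 * k)\<^sup>2 div 4 + (2 * k choose 2))"
    using shortest_odd_ear_bound[OF AB lk free k n Q deg q]
      shortest_odd_ear_bound[OF BA(1,2) _ free k n, of q] Q deg BA(3) by auto
  with e show False by simp
qed

end

subsection \<open>No odd ears: the extremal structure\<close>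

text \<open>The number of edges of \<open>H(n, m - 1)\<close>.\<close>

definition ext_num :: "nat \<Rightarrow> nat \<Rightarrow> nat" where
  "ext_num n m = (n - m)\<^sup>2 div 4 + (Suc m choose 2)"

text \<open>Moving a vertex from the bipartite part to the clique gains \<open>m + 1\<close> edges
  and loses \<open>(n - m) div 2\<close>, which is at least \<open>m + 2\<close> here.\<close>

lemma ext_num_Suc_less:
  assumes "3 * m + 4 \<le> n"
  shows "ext_num n (Suc m) < ext_num n m"
proof -
  define N where "N = n - Suc m"
  have N: "n - m = Suc N" "2 * m + 3 \<le> N" using assms by (auto simp: N_def)
  have "N\<^sup>2 div 4 + (m + 2) \<le> (Suc N)\<^sup>2 div 4"
  proof -
    consider j where "N = 2 * j" | j where "N = 2 * j + 1" by (metis evenE oddE)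
    then show ?thesis
    proof cases
      case 1
      then have "m + 2 \<le> j" using N(2) by presburger
      then show ?thesis by (simp add: 1 power2_eq_square algebra_simps)
    next
      case 2
      then have "m + 1 \<le> j" using N(2) by presburger
      then show ?thesis by (simp add: 2 power2_eq_square algebra_simps)
    qed
  qed
  then show ?thesis
    unfolding ext_num_def N_def[symmetric] N(1) by (simp add: numeral_2_eq_2)
qed

lemma ext_num_less:
  assumes "m < m'" "3 * m' + 1 \<le> n"
  shows "ext_num n m' < ext_num n m"
  using assms
proof (induction m')
  case (Suc m')
  have "ext_num n (Suc m') < ext_num n m'" using Suc.prems by (intro ext_num_Suc_less) simp
  then show ?case using Suc by (cases "m = m'") auto
qed simp

text \<open>This is one step of greedy colouring: a vertex with at most \<open>z + 1\<close>
  coloured neighbours has at most half of them in one of the classes.\<close>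

lemma square_div_4_step: "z\<^sup>2 div 4 + Suc z div 2 \<le> (Suc z)\<^sup>2 div 4" for z :: nat
proof (cases "even z")
  case True
  then obtain j where "z = 2 * j" by blast
  then show ?thesis by (simp add: power2_eq_square algebra_simps)
next
  case False
  then obtain j where "z = 2 * j + 1" by (rule oddE)
  then show ?thesis by (simp add: power2_eq_square algebra_simps)
qed

lemma square_div_4_less: "z \<le> t \<Longrightarrow> 1 \<le> t \<Longrightarrow> z\<^sup>2 div 4 < (Suc t)\<^sup>2 div 4" for z t :: nat
proof -
  assume "z \<le> t" "1 \<le> t"
  have "z\<^sup>2 div 4 \<le> t\<^sup>2 div 4" using \<open>z \<le> t\<close> by (intro div_le_mono power_mono) auto
  also have "\<dots> < t\<^sup>2 div 4 + Suc t div 2" using \<open>1 \<le> t\<close> by simp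
  also have "\<dots> \<le> (Suc t)\<^sup>2 div 4" by (rule square_div_4_step)
  finally show ?thesis .
qed

lemma balanced_if_max_prod:
  fixes a b :: nat
  assumes "a \<le> b" "(a + b)\<^sup>2 div 4 \<le> a * b"
  shows "a = (a + b) div 2"
proof -
  obtain d where b: "b = a + d" using assms(1) le_Suc_ex by blast
  have "(a + b)\<^sup>2 = 4 * (a * b) + d * d" unfolding b by (simp add: power2_eq_square algebra_simps)
  then have "(a + b)\<^sup>2 div 4 = a * b + d * d div 4" by simp
  then have "d * d div 4 = 0" using assms(2) by simp
  then have "d * d < 4" by simp
  then have "d < 2" using mult_le_mono[of 2 d 2 d] by (cases "d < 2") auto
  then show ?thesis unfolding b by simp
qed

context fgraph
begin

text \<open>An ear of the enlarged set that ends at \<open>v\<close> can be prolonged by whichever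
  of \<open>x\<close> and \<open>y\<close> is not its other end, which gives an odd ear of the old
  set.\<close>

lemma no_odd_ear_insert:
  assumes no: "\<And>p. \<not> odd_ear A B p" and AB: "A \<inter> B = {}" and v: "v \<notin> A \<union> B"
    and xy: "x \<in> A" "y \<in> A" "adj v x" "adj v y" "x \<noteq> y"
  shows "\<not> odd_ear A (insert v B) p"
proof
  have first: False if ear: "odd_ear A (insert v B) q" and hd: "hd q = v" for q
  proof -
    obtain v' m z where q': "q = v' # m @ [z]" "path (v' # m @ [z])" "z \<in> A \<union> insert v B"
      "set m \<inter> (A \<union> insert v B) = {}" "(v' \<in> A \<longleftrightarrow> z \<in> A) \<longleftrightarrow> even (length m)"
      using ear unfolding odd_ear_conv by blast
    have "v' = v" using hd q'(1) by simp
    note q = q'(2-5)[unfolded this]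
    obtain u where u: "u \<in> A" "adj v u" "u \<noteq> z" using xy by metis
    have "z \<noteq> v" using q(1) by (auto simp: path_def)
    have "u \<noteq> v" "u \<notin> set m" using u v q(3) by auto
    then have "path (u # (v # m) @ [z])"
      using q(1) u adj_sym[OF u(2)] adj_V2[OF u(2)] unfolding path_Cons[of u] by simp
    moreover have "z \<in> A \<union> B" using q(2) \<open>z \<noteq> v\<close> by simp
    moreover have "set (v # m) \<inter> (A \<union> B) = {}" using q(3) v by auto
    moreover have "(u \<in> A \<longleftrightarrow> z \<in> A) \<longleftrightarrow> even (length (v # m))" using q(4) u(1) v by auto
    ultimately have "odd_ear A B (u # (v # m) @ [z])" using u(1) unfolding odd_ear_conv by blast
    then show False using no by blast
  qed
  assume ear: "odd_ear A (insert v B) p"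
  show False
  proof (cases "hd p = v \<or> last p = v")
    case True
    moreover have "p \<noteq> []" using ear by (auto simp: odd_ear_def)
    ultimately show ?thesis using first[OF ear] first[OF odd_ear_rev[OF ear]] hd_rev[of p] by metis
  next
    case False
    then have "odd_ear A B p" using ear by (auto simp: odd_ear_def)
    then show ?thesis using no by blast
  qed
qed

lemma odd_ear_swap_iff: "A \<inter> B = {} \<Longrightarrow> odd_ear A B p \<longleftrightarrow> odd_ear B A p"
  using odd_ear_swap[of A B p] odd_ear_swap[of B A p] by (simp only: inf_commute) blast

lemma no_odd_ear_classes:
  assumes no: "\<And>p. \<not> odd_ear A B p" and AB: "A \<union> B \<subseteq> V" "A \<inter> B = {}" and v: "v \<notin> A \<union> B"
    and xy: "x \<in> A \<union> B" "y \<in> A \<union> B" "adj v x" "adj v y" "x \<noteq> y"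
  shows "x \<in> A \<longleftrightarrow> y \<in> A"
proof (rule ccontr)
  assume neg: "\<not> ?thesis"
  have "path [x, v, y]"
    using xy v adj_sym[OF xy(3)] adj_V[OF xy(3)] adj_V2[OF xy(3)] adj_V2[OF xy(4)]
    by (auto simp: path_def)
  then have "odd_ear A B [x, v, y]" using neg xy v by (auto simp: odd_ear_def)
  then show False using no by blast
qed

text \<open>In an extension with the most vertices, an outside vertex with two neighbours in it
  would see a single class, since otherwise it forms an ear with them. It could then be added to the
  other class.\<close>

lemma maximal_extension:
  assumes AB: "A \<union> B \<subseteq> V" "A \<inter> B = {}" and no: "\<And>p. \<not> odd_ear A B p"
  shows "\<exists>A' B'. A \<union> B \<subseteq> A' \<union> B' \<and> A' \<union> B' \<subseteq> V \<and> A' \<inter> B' = {} \<and> (\<forall>p. \<not> odd_ear A' B' p)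
    \<and> (\<forall>v\<in>V - (A' \<union> B'). card (nb (A' \<union> B') v) \<le> 1)"
proof -
  define P where "P X \<longleftrightarrow> A \<union> B \<subseteq> fst X \<union> snd X \<and> fst X \<union> snd X \<subseteq> V \<and> fst X \<inter> snd X = {}
    \<and> (\<forall>p. \<not> odd_ear (fst X) (snd X) p)" for X
  have "P (A, B)" using assms by (simp add: P_def)
  moreover have "\<forall>X. P X \<longrightarrow> card (fst X \<union> snd X) < Suc (card V)"
    unfolding P_def less_Suc_eq_le using card_mono[OF finite_V] by blast
  ultimately have "\<exists>X. P X \<and> (\<forall>Y. P Y \<longrightarrow> card (fst Y \<union> snd Y) \<le> card (fst X \<union> snd X))"
    by (rule ex_has_greatest_nat)
  then obtain A' B' where X: "P (A', B')" and max: "\<And>Y. P Y \<Longrightarrow> card (fst Y \<union> snd Y) \<le> card (A' \<union> B')"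
    by auto
  have X': "A \<union> B \<subseteq> A' \<union> B'" "A' \<union> B' \<subseteq> V" "A' \<inter> B' = {}" "\<And>p. \<not> odd_ear A' B' p"
    using X by (auto simp: P_def)
  have "card (nb (A' \<union> B') v) \<le> 1" if v: "v \<in> V - (A' \<union> B')" for v
  proof (rule ccontr)
    assume "\<not> ?thesis"
    then have "\<not> (\<exists>x. nb (A' \<union> B') v \<subseteq> {x})" using card_mono[of "{_}" "nb (A' \<union> B') v"] by fastforce
    then obtain x y where xy: "x \<in> A' \<union> B'" "y \<in> A' \<union> B'" "adj v x" "adj v y" "x \<noteq> y"
      unfolding nb_def by blast
    have vD: "v \<notin> A' \<union> B'" using v by blast
    have same: "x \<in> A' \<longleftrightarrow> y \<in> A'" by (rule no_odd_ear_classes[OF X'(4,2,3) vD xy])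
    have big: "card (insert v (A' \<union> B')) = Suc (card (A' \<union> B'))"
      using finite_sub[OF X'(2)] vD by simp
    show False
    proof (cases "x \<in> A'")
      case True
      then have "y \<in> A'" using same by blast
      from no_odd_ear_insert[OF X'(4,3) vD True this xy(3-5)]
      have "P (A', insert v B')" using X' v by (auto simp: P_def)
      from max[OF this] big show False by simp
    next
      case False
      then have xyB: "x \<in> B'" "y \<in> B'" using same xy by blast+
      have no': "\<not> odd_ear B' A' p" for p using X'(4)[of p] odd_ear_swap_iff[OF X'(3), of p] by simp
      have "\<not> odd_ear B' (insert v A') p" for p
        by (rule no_odd_ear_insert[OF no' _ _ xyB xy(3-5)]) (use X'(3) vD in auto)
      then have "\<not> odd_ear (insert v A') B' p" for p
        using odd_ear_swap_iff[of "insert v A'" B' p] X'(3) vD by auto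
      then have "P (insert v A', B')" using X' v by (auto simp: P_def)
      from max[OF this] big show False by simp
    qed
  qed
  then show ?thesis using X' by blast
qed

text \<open>Start from the proper colouring by \<open>A\<close> and \<open>B\<close> and add the
  vertices of \<open>Z\<close> one by one to the class with fewer neighbours. Each has at most one
  neighbour in \<open>A \<union> B\<close> and the rest among the earlier vertices of
  \<open>Z\<close>.\<close>

lemma greedy_colouring:
  assumes "finite Z" "A \<union> B \<subseteq> V" "A \<inter> B = {}" "dn A A = 0" "dn B B = 0"
    and "Z \<subseteq> V - (A \<union> B)" "\<And>v. v \<in> Z \<Longrightarrow> card (nb (A \<union> B) v) \<le> 1"
  shows "\<exists>S T. S \<inter> T = {} \<and> S \<union> T = A \<union> B \<union> Z \<and> dn S S + dn T T \<le> 2 * ((card Z)\<^sup>2 div 4)"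
  using assms(1,6,7)
proof (induction Z rule: finite_induct)
  case empty
  then show ?case using assms by (intro exI[of _ A] exI[of _ B]) simp
next
  case (insert v Z)
  then obtain S T where ST: "S \<inter> T = {}" "S \<union> T = A \<union> B \<union> Z" "dn S S + dn T T \<le> 2 * ((card Z)\<^sup>2 div 4)"
    by auto
  have v: "v \<notin> S" "v \<notin> T" "insert v (S \<union> T) = A \<union> B \<union> insert v Z"
    using ST(2) insert.hyps insert.prems by auto
  have fin: "finite S" "finite T"
    using ST(2) insert.hyps finite_sub[OF assms(2)] by (metis finite_Un)+
  have "(A \<union> B) \<inter> Z = {}" using insert.prems by blast
  then have "card (nb S v) + card (nb T v) = card (nb (A \<union> B) v) + card (nb Z v)"
    using card_nb_Un[OF ST(1), of v] card_nb_Un[of "A \<union> B" Z v] ST(2) by simp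
  moreover have "card (nb Z v) \<le> card Z" by (rule card_nb_le[OF insert.hyps(1)])
  ultimately have sum: "card (nb S v) + card (nb T v) \<le> Suc (card Z)"
    using insert.prems(2)[of v] by simp
  have step: "(card Z)\<^sup>2 div 4 + Suc (card Z) div 2 \<le> (card (insert v Z))\<^sup>2 div 4"
    using square_div_4_step[of "card Z"] insert.hyps by simp
  show ?case
  proof (cases "card (nb S v) \<le> card (nb T v)")
    case True
    then have "card (nb S v) \<le> Suc (card Z) div 2" using sum by simp
    then have "dn (insert v S) (insert v S) + dn T T \<le> 2 * ((card (insert v Z))\<^sup>2 div 4)"
      using dn_insert_self[OF fin(1) v(1)] ST(3) step by linarith
    then show ?thesis using ST(1) v by (intro exI[of _ "insert v S"] exI[of _ T]) auto
  next
    case False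
    then have "card (nb T v) \<le> Suc (card Z) div 2" using sum by simp
    then have "dn S S + dn (insert v T) (insert v T) \<le> 2 * ((card (insert v Z))\<^sup>2 div 4)"
      using dn_insert_self[OF fin(2) v(2)] ST(3) step by linarith
    then show ?thesis using ST(1) v by (intro exI[of _ S] exI[of _ "insert v T"]) auto
  qed
qed

lemma no_adj_in_class:
  assumes "\<And>p. \<not> odd_ear A B p" "A \<inter> B = {}" "u \<in> A \<and> v \<in> A \<or> u \<in> B \<and> v \<in> B"
  shows "\<not> adj u v"
proof
  assume "adj u v"
  then have "path [u, v]" using adj_irrefl adj_V adj_V2 by (auto simp: path_def)
  then have "odd_ear A B [u, v]" using assms(2,3) by (auto simp: odd_ear_def)
  then show False using assms(1) by blast
qed

lemma dn_zero_if_no_odd_ear: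
  assumes "\<And>p. \<not> odd_ear A B p" "A \<inter> B = {}"
  shows "dn A A = 0" "dn B B = 0"
proof -
  have "\<And>u. u \<in> A \<Longrightarrow> nb A u = {}" "\<And>u. u \<in> B \<Longrightarrow> nb B u = {}"
    using no_adj_in_class[OF assms] by (auto simp: nb_def)
  then show "dn A A = 0" "dn B B = 0" by (auto simp: dn_def)
qed

lemma adj_if_dn_full:
  assumes "finite X" "finite Y" "dn X Y = card X * card Y" "x \<in> X" "y \<in> Y"
  shows "adj x y"
proof -
  have "card (nb Y x) = card Y"
  proof (rule sum_mono_inv[of "\<lambda>x. card (nb Y x)" X "\<lambda>x. card Y"])
    show "(\<Sum>x\<in>X. card (nb Y x)) = (\<Sum>x\<in>X. card Y)" using assms(3) by (simp add: dn_def)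
  qed (use assms card_nb_le in auto)
  then have "nb Y x = Y" using card_subset_eq[OF assms(2) nb_subset] by blast
  then show ?thesis using assms(5) by (auto simp: nb_def)
qed

lemma adj_if_dn_self_full:
  assumes "finite X" "dn X X = card X * (card X - 1)" "x \<in> X" "y \<in> X" "x \<noteq> y"
  shows "adj x y"
proof -
  have sub: "nb X x \<subseteq> X - {x}" for x using adj_irrefl by (auto simp: nb_def)
  have le: "card (nb X x) \<le> card X - 1" if "x \<in> X" for x
    using card_mono[OF _ sub[of x]] that assms(1) by simp
  have "card (nb X x) = card X - 1"
  proof (rule sum_mono_inv[of "\<lambda>x. card (nb X x)" X "\<lambda>x. card X - 1"])
    show "(\<Sum>x\<in>X. card (nb X x)) = (\<Sum>x\<in>X. card X - 1)" using assms(2) by (simp add: dn_def)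
  qed (use assms le in auto)
  then have "nb X x = X - {x}" using assms(1,3) by (intro card_subset_eq sub) auto
  then have "y \<in> nb X x" using assms(4,5) by blast
  then show ?thesis by (simp add: nb_def)
qed

lemma ear_through_outside:
  assumes no: "\<And>p. \<not> odd_ear A B p" and AB: "A \<union> B \<subseteq> V"
    and p: "path m" "m \<noteq> []" "set m \<inter> (A \<union> B) = {}"
    and xy: "x \<in> A \<union> B" "y \<in> A \<union> B" "x \<noteq> y" "adj (hd m) x" "adj (last m) y"
  shows "(x \<in> A \<longleftrightarrow> y \<in> A) \<longleftrightarrow> odd (length m)"
proof -
  have "x \<notin> set m" "y \<notin> set m" using p xy by blast+
  then have "path (m @ [y])" using p xy AB by (auto simp: path_append path_def[of "[y]"])
  then have "path (x # m @ [y])"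
    using p xy \<open>x \<notin> set m\<close> AB adj_sym[OF xy(4)] by (auto simp: path_Cons)
  then show ?thesis using no[of "x # m @ [y]"] xy p(3) unfolding odd_ear_conv by blast
qed

text \<open>Paths through the clique from \<open>v\<close> to \<open>w\<close> with two and with
  three vertices would force opposite parities on \<open>x\<close> and \<open>y\<close>. So
  different attachments leave no room for a third vertex in \<open>Z\<close>.\<close>

lemma common_attachment:
  assumes no: "\<And>p. \<not> odd_ear A B p" and AB: "A \<union> B \<subseteq> V" and Z: "Z \<subseteq> V - (A \<union> B)" "finite Z"
    and clique: "\<And>v w. v \<in> Z \<Longrightarrow> w \<in> Z \<Longrightarrow> v \<noteq> w \<Longrightarrow> adj v w"
    and vw: "v \<in> Z" "w \<in> Z" "v \<noteq> w"
    and xy: "x \<in> A \<union> B" "y \<in> A \<union> B" "adj v x" "adj w y" "x \<noteq> y"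
  shows "card Z = 2" "\<not> (x \<in> A \<longleftrightarrow> y \<in> A)"
proof -
  have vw': "v \<in> V" "w \<in> V" "v \<notin> A \<union> B" "w \<notin> A \<union> B" using vw Z by auto
  have "path [v, w]" using vw vw' clique by (simp add: path_def)
  from ear_through_outside[OF no AB this, of x y] xy vw'
  have diff: "(x \<in> A \<longleftrightarrow> y \<in> A) \<longleftrightarrow> odd (length [v, w])" by simp
  then show neq: "\<not> (x \<in> A \<longleftrightarrow> y \<in> A)" by simp
  have "Z \<subseteq> {v, w}"
  proof
    fix z assume z: "z \<in> Z"
    show "z \<in> {v, w}"
    proof (rule ccontr)
      assume "z \<notin> {v, w}"
      then have "path [v, z, w]" using vw vw' z Z clique by (auto simp: path_def)
      moreover have "set [v, z, w] \<inter> (A \<union> B) = {}" using vw' z Z by auto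
      ultimately have "(x \<in> A \<longleftrightarrow> y \<in> A) \<longleftrightarrow> odd (length [v, z, w])"
        using ear_through_outside[OF no AB, of "[v, z, w]" x y] xy by simp
      then show False using neq by simp
    qed
  qed
  then have "Z = {v, w}" using vw by blast
  then show "card Z = 2" using vw by simp
qed

text \<open>The upper bound for \<open>dn V V\<close> is a sum of separate bounds for the bipartite
  part, the attaching edges and the outside vertices. Once \<open>m = t + 1\<close>, all of them are
  equalities and determine the graph up to the attachment of \<open>Z\<close>.\<close>

lemma extremal_structure:
  assumes k: "2 \<le> k" and t: "1 \<le> t" "t \<le> 2 * k - 2" and n: "card V = n" "252 * t\<^sup>2 * k \<le> n"
    and free: "avoids_cycle (2 * k + 1)"
    and cut: "\<And>S T. S \<inter> T = {} \<Longrightarrow> S \<union> T = V \<Longrightarrow> 2 * ((Suc t)\<^sup>2 div 4) \<le> dn S S + dn T T"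
    and e: "2 * ext_num n (Suc t) \<le> dn V V"
  shows "dn V V = 2 * ext_num n (Suc t) \<and>
    (\<exists>A B Z u. V = A \<union> B \<union> Z \<and> A \<inter> B = {} \<and> (A \<union> B) \<inter> Z = {} \<and> card A = (n - Suc t) div 2
      \<and> card B = (n - Suc t) - (n - Suc t) div 2 \<and> card Z = Suc t \<and> u \<in> A \<union> B
      \<and> (\<forall>x y. adj x y \<longleftrightarrow> x \<in> A \<and> y \<in> B \<or> x \<in> B \<and> y \<in> A \<or> x \<noteq> y \<and> x \<in> insert u Z \<and> y \<in> insert u Z))"
proof -
  have "k \<le> t\<^sup>2 * k" using t by simp
  then have kn: "252 * k \<le> n" using n(2) by linarith
  have tk: "Suc t \<le> 2 * k - 1" using t k by linarith
  \<comment> \<open>That is, the number of edges is at least \<open>n * n / 4 - t * n\<close>, which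
    is the input of \<open>core_exists\<close>.\<close>
  have "n * n \<le> 2 * dn V V + 4 * t * n"
  proof -
    define N where "N = n - Suc t"
    have nN: "n = N + Suc t" using tk kn by (simp add: N_def)
    have "n * n = N * N + 2 * N * Suc t + Suc t * Suc t" unfolding nN by (simp add: algebra_simps)
    moreover have "N * N \<le> 4 * (N\<^sup>2 div 4) + 3" by (rule square_le_four_div)
    moreover have "2 * ext_num n (Suc t) = 2 * (N\<^sup>2 div 4) + Suc (Suc t) * Suc t"
      unfolding ext_num_def N_def[symmetric] using two_mult_choose_two[of "Suc (Suc t)"] by simp
    moreover have "4 * t * n = 4 * t * N + 4 * t * Suc t" unfolding nN by (simp add: algebra_simps)
    moreover have "2 * N * Suc t \<le> 4 * t * N"
    proof -
      have "(2 * N) * Suc t \<le> (2 * N) * (2 * t)" using t by (intro mult_left_mono) auto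
      then show ?thesis by (simp add: ac_simps)
    qed
    moreover have "Suc t * Suc t + 3 \<le> 2 * (Suc (Suc t) * Suc t) + 4 * t * Suc t"
      using t by (simp add: algebra_simps)
    ultimately show ?thesis using e by linarith
  qed
  from core_exists[OF free k t(1) n this] obtain A0 B0 where
    core: "A0 \<union> B0 \<subseteq> V" "A0 \<inter> B0 = {}" "linked k A0 B0" "8 * card (V - (A0 \<union> B0)) \<le> n"
      "\<And>v. v \<in> V - (A0 \<union> B0) \<Longrightarrow> 12 * card (nb V v) \<le> 5 * n" by blast
  have "3 * (2 * k - 1) + 1 \<le> n" using kn k by linarith
  then have le: "ext_num n (2 * k - 1) \<le> ext_num n (Suc t)"
    using ext_num_less[of "Suc t" "2 * k - 1" n] tk by (cases "Suc t = 2 * k - 1") auto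
  have "ext_num n (2 * k - 1) = (n + 1 - 2 * k)\<^sup>2 div 4 + (2 * k choose 2)"
    using k by (simp add: ext_num_def Suc_diff_le)
  moreover have "2 * ext_num n (2 * k - 1) \<le> dn V V" using e le by linarith
  ultimately have "2 * ((n + 1 - 2 * k)\<^sup>2 div 4 + (2 * k choose 2)) \<le> dn V V" by simp
  from no_odd_ear[OF core(1-3) free k n(1) kn core(4,5) this]
  have no0: "\<not> odd_ear A0 B0 p" for p by blast
  obtain A B where sub: "A0 \<union> B0 \<subseteq> A \<union> B" and AB: "A \<union> B \<subseteq> V" "A \<inter> B = {}"
    and no: "\<And>p. \<not> odd_ear A B p" and one: "\<And>v. v \<in> V - (A \<union> B) \<Longrightarrow> card (nb (A \<union> B) v) \<le> 1"
    using maximal_extension[OF core(1,2) no0] by blast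
  let ?D = "A \<union> B"
  define Z where "Z = V - ?D"
  have Z: "Z \<subseteq> V - ?D" "?D \<inter> Z = {}" "?D \<union> Z = V" using AB by (auto simp: Z_def)
  have fin: "finite A" "finite B" "finite ?D" "finite Z"
    using finite_V finite_sub AB(1) by (auto simp: Z_def)
  have zero: "dn A A = 0" "dn B B = 0" by (rule dn_zero_if_no_odd_ear[OF no AB(2)])+
  define m where "m = card Z"
  have "card Z \<le> card (V - (A0 \<union> B0))" unfolding Z_def using sub finite_V by (intro card_mono) auto
  then have mn: "8 * m \<le> n" using core(4) by (simp add: m_def)
  obtain S T where ST: "S \<inter> T = {}" "S \<union> T = V" "dn S S + dn T T \<le> 2 * (m\<^sup>2 div 4)"
    using greedy_colouring[OF fin(4) AB zero Z(1)] one Z(1,3) unfolding m_def by blast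
  have "2 * ((Suc t)\<^sup>2 div 4) \<le> 2 * (m\<^sup>2 div 4)" using cut[OF ST(1,2)] ST(3) by linarith
  then have tm: "Suc t \<le> m" using square_div_4_less[OF _ t(1), of m] by linarith
  have nm: "n = card A + card B + m"
    using card_Un_disjoint[OF fin(1,2) AB(2)] card_Un_disjoint[OF fin(3,4) Z(2)] Z(3) n(1)
    by (simp add: m_def)
  have "dn ?D ?D = 2 * dn A B" using dn_Un_self[OF fin(1,2) AB(2)] zero by simp
  then have dV: "dn V V = 2 * dn A B + 2 * dn Z ?D + dn Z Z"
    using dn_Un_self[OF fin(3,4) Z(2)] dn_commute[OF fin(3,4)] Z(3) by simp
  have dAB: "dn A B \<le> card A * card B" using fin by (intro dn_le)
  have "dn Z ?D \<le> (\<Sum>v\<in>Z. 1)" unfolding dn_def using one Z(1) by (intro sum_mono) blast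
  then have dZD: "dn Z ?D \<le> m" by (simp add: m_def)
  have dZ: "dn Z Z \<le> m * (m - 1)" using dn_self_le[OF fin(4)] by (simp add: m_def)
  have AB4: "card A * card B \<le> (n - m)\<^sup>2 div 4"
  proof -
    have "4 * (card A * card B) div 4 \<le> (card A + card B) * (card A + card B) div 4"
      by (intro div_le_mono four_mult_le_square)
    then show ?thesis using nm by (simp add: power2_eq_square)
  qed
  have Fm: "2 * ext_num n m = 2 * ((n - m)\<^sup>2 div 4) + (2 * m + m * (m - 1))"
    unfolding ext_num_def using two_mult_choose_two[of "Suc m"] by (cases m) (simp_all add: algebra_simps)
  have up: "dn V V \<le> 2 * ext_num n m" using dV dAB dZD dZ AB4 Fm by linarith
  have "m = Suc t"
  proof (rule ccontr)
    assume "m \<noteq> Suc t"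
    then have "ext_num n m < ext_num n (Suc t)" using tm mn tk kn k by (intro ext_num_less) auto
    then show False using e up by linarith
  qed
  then have eq: "dn V V = 2 * ext_num n (Suc t)" using e up by simp
  then have eqm: "dn V V = 2 * ext_num n m" using \<open>m = Suc t\<close> by simp
  have tight: "dn A B = card A * card B" "card A * card B = (n - m)\<^sup>2 div 4" "dn Z ?D = m" "dn Z Z = m * (m - 1)"
    using eqm dV dAB dZD dZ AB4 Fm by linarith+
  have adjAB: "adj x y" if "x \<in> A" "y \<in> B" for x y
    using adj_if_dn_full[OF fin(1,2) tight(1) that] .
  have adjZ: "adj x y" if "x \<in> Z" "y \<in> Z" "x \<noteq> y" for x y
    using adj_if_dn_self_full[OF fin(4) _ that] tight(4) by (simp add: m_def)
  have c1: "card (nb ?D v) = 1" if "v \<in> Z" for v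
  proof (rule sum_mono_inv[of "\<lambda>v. card (nb ?D v)" Z "\<lambda>_. 1"])
    show "(\<Sum>v\<in>Z. card (nb ?D v)) = (\<Sum>v\<in>Z. 1)" using tight(3) by (simp add: dn_def m_def)
  qed (use that one Z(1) fin in auto)
  define h where "h v = (THE x. nb ?D v = {x})" for v
  have h: "nb ?D v = {h v}" if v: "v \<in> Z" for v
  proof -
    obtain x where "nb ?D v = {x}" using c1[OF v] card_1_singletonE by blast
    then show ?thesis unfolding h_def by simp
  qed
  have hD: "h v \<in> ?D" "adj v (h v)" if "v \<in> Z" for v using h[OF that] unfolding nb_def by blast+
  have noAB: "\<not> adj x y" if "x \<in> A \<and> y \<in> A \<or> x \<in> B \<and> y \<in> B" for x y
    by (rule no_adj_in_class[OF no AB(2) that])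
  have same: "h v = h w" if vw: "v \<in> Z" "w \<in> Z" for v w
  proof (rule ccontr)
    assume neq: "h v \<noteq> h w"
    then have "v \<noteq> w" by blast
    note att = common_attachment[OF no AB(1) Z(1) fin(4) adjZ vw \<open>v \<noteq> w\<close> hD(1)[OF vw(1)] hD(1)[OF vw(2)]
        hD(2)[OF vw(1)] hD(2)[OF vw(2)] neq]
    have "t = 1" using att(1) \<open>m = Suc t\<close> by (simp add: m_def)
    have Zvw: "Z = {v, w}"
      using att(1) vw \<open>v \<noteq> w\<close> fin(4) by (metis card_2_iff card_subset_eq empty_subsetI insert_subset)
    \<comment> \<open>Different attachments remain possible only for \<open>t = 1\<close>. Then each
      of the two outside vertices can be put into the class opposite to its attachment, and no edge
      is monochromatic, against the lower bound on cuts.\<close>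
    have split: False if ab: "Z = {a, b}" "a \<noteq> b" "h a \<in> A" "h b \<in> B" for a b
    proof -
      have ab': "a \<in> Z" "b \<in> Z" "a \<notin> ?D" "b \<notin> ?D" using ab Z(2) by auto
      have "nb A b \<subseteq> {h b}" "nb B a \<subseteq> {h a}"
        using nb_mono[of A ?D b] nb_mono[of B ?D a] h[OF ab'(1)] h[OF ab'(2)] by simp_all
      moreover have "h b \<notin> A" "h a \<notin> B" using ab(3,4) AB(2) by blast+
      ultimately have "nb A b = {}" "nb B a = {}" using nb_subset[of A b] nb_subset[of B a] by blast+
      then have "dn (insert b A) (insert b A) = 0" "dn (insert a B) (insert a B) = 0"
        using dn_insert_self[OF fin(1), of b] dn_insert_self[OF fin(2), of a] zero ab' by auto
      moreover have "insert b A \<inter> insert a B = {}" using ab(2) ab'(3,4) AB(2) by blast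
      moreover have "insert b A \<union> insert a B = V" using ab(1) Z(3) by blast
      ultimately have "2 * ((Suc t)\<^sup>2 div 4) \<le> 0" using cut[of "insert b A" "insert a B"] by simp
      then show False using \<open>t = 1\<close> by (simp add: power2_eq_square)
    qed
    show False
    proof (cases "h v \<in> A")
      case True
      then have "h w \<in> B" using att(2) hD(1)[OF vw(2)] by blast
      then show False using split[OF Zvw \<open>v \<noteq> w\<close> True] by blast
    next
      case False
      then have "h v \<in> B" "h w \<in> A" using att(2) hD(1)[OF vw(1)] by blast+
      moreover have "Z = {w, v}" using Zvw by blast
      ultimately show False using split[of w v] \<open>v \<noteq> w\<close> by blast
    qed
  qed
  have "Z \<noteq> {}" using tm by (auto simp: m_def)
  then obtain z0 where z0: "z0 \<in> Z" by blast
  define u where "u = h z0"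
  have uD: "u \<in> ?D" using hD z0 by (simp add: u_def)
  have adjZD: "adj v x \<longleftrightarrow> x = u" if "v \<in> Z" "x \<in> ?D" for v x
  proof -
    have "nb ?D v = {u}" using h[OF that(1)] same[OF that(1) z0] by (simp add: u_def)
    then show ?thesis using that(2) unfolding nb_def by blast
  qed
  have adj: "adj x y \<longleftrightarrow> x \<in> A \<and> y \<in> B \<or> x \<in> B \<and> y \<in> A \<or> x \<noteq> y \<and> x \<in> insert u Z \<and> y \<in> insert u Z" for x y
  proof (cases "x \<in> V \<and> y \<in> V")
    case False
    then show ?thesis using adj_V adj_V2 AB(1) Z(1) uD by blast
  next
    case True
    then consider "x \<in> Z" "y \<in> Z" | "x \<in> Z" "y \<in> ?D" | "x \<in> ?D" "y \<in> Z" | "x \<in> ?D" "y \<in> ?D"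
      using Z(3) by blast
    then show ?thesis
    proof cases
      case 1
      then have "x \<notin> ?D" "y \<notin> ?D" using Z(2) by blast+
      then show ?thesis using 1 adjZ[of x y] adj_irrefl[of x] by blast
    next
      case 2
      then have "x \<notin> ?D" "y \<notin> Z" using Z(2) by blast+
      then show ?thesis using 2 adjZD[of x y] uD by blast
    next
      case 3
      then have "y \<notin> ?D" "x \<notin> Z" using Z(2) by blast+
      then show ?thesis using 3 adjZD[of y x] uD adj_commute[of x y] by blast
    next
      case 4
      then have "x \<notin> Z" "y \<notin> Z" using Z(2) by blast+
      then show ?thesis
        using 4 adjAB[of x y] adjAB[of y x] noAB[of x y] adj_commute[of x y] AB(2) by blast
    qed
  qed
  have N: "n - Suc t = card A + card B" using nm \<open>m = Suc t\<close> by simp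
  have nN: "n - m = card A + card B" using nm by simp
  show ?thesis
  proof (cases "card A \<le> card B")
    case True
    have "card A = (card A + card B) div 2"
      using balanced_if_max_prod[OF True] tight(2) unfolding nN by simp
    then have "card A = (n - Suc t) div 2" "card B = (n - Suc t) - (n - Suc t) div 2"
      unfolding N by linarith+
    moreover have "V = A \<union> B \<union> Z" using Z(3) by simp
    moreover have "card Z = Suc t" using \<open>m = Suc t\<close> by (simp add: m_def)
    ultimately show ?thesis using eq AB(2) Z(2) uD adj by blast
  next
    case False
    have "card B = (card B + card A) div 2"
      using balanced_if_max_prod[of "card B" "card A"] False tight(2) unfolding nN by (simp add: ac_simps)
    then have "card B = (n - Suc t) div 2" "card A = (n - Suc t) - (n - Suc t) div 2"
      unfolding N by linarith+
    moreover have "V = B \<union> A \<union> Z" using Z(3) by blast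
    moreover have "card Z = Suc t" using \<open>m = Suc t\<close> by (simp add: m_def)
    moreover have "B \<inter> A = {}" "(B \<union> A) \<inter> Z = {}" "u \<in> B \<union> A" using AB(2) Z(2) uD by blast+
    moreover have "adj x y \<longleftrightarrow> x \<in> B \<and> y \<in> A \<or> x \<in> A \<and> y \<in> B \<or> x \<noteq> y \<and> x \<in> insert u Z \<and> y \<in> insert u Z" for x y
      using adj[of x y] by blast
    ultimately show ?thesis using eq by blast
  qed
qed

end

subsection \<open>Back to graphs\<close>

lemma card_ordered_pairs:
  assumes "finite E" "\<And>e. e \<in> E \<Longrightarrow> card e = 2"
  shows "card {(x, y). {x, y} \<in> E} = 2 * card E"
proof -
  have pairs: "finite {(x, y). {x, y} = e}" "card {(x, y). {x, y} = e} = 2" if e: "e \<in> E" for e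
  proof -
    obtain a b where ab: "e = {a, b}" "a \<noteq> b" using assms(2)[OF e] card_2_iff by metis
    then have "{(x, y). {x, y} = e} = {(a, b), (b, a)}" by (auto simp: doubleton_eq_iff)
    then show "finite {(x, y). {x, y} = e}" "card {(x, y). {x, y} = e} = 2" using ab(2) by auto
  qed
  have "{(x, y). {x, y} \<in> E} = (\<Union>e\<in>E. {(x, y). {x, y} = e})" by auto
  also have "card \<dots> = (\<Sum>e\<in>E. card {(x, y). {x, y} = e})"
    by (rule card_UN_disjoint) (use assms pairs in auto)
  also have "\<dots> = 2 * card E" using pairs by simp
  finally show ?thesis .
qed

lemma card_2_cases:
  assumes "card e = 2"
  obtains x y where "e = {x, y}" "x \<noteq> y"
  using assms card_2_iff by metis

abbreviation edge_rel :: "'a graph \<Rightarrow> 'a \<Rightarrow> 'a \<Rightarrow> bool" where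
  "edge_rel G x y \<equiv> {x, y} \<in> edges G"

lemma finite_edges: "simple_graph G \<Longrightarrow> finite (edges G)"
  by (rule finite_subset[of _ "Pow (verts G)"]) (auto simp: simple_graph_def)

lemma fgraph_edge_rel:
  assumes "simple_graph G"
  shows "fgraph (verts G) (edge_rel G)"
proof
  show "finite (verts G)" using assms by (simp add: simple_graph_def)
  show "edge_rel G x y \<Longrightarrow> edge_rel G y x" for x y by (simp add: insert_commute)
  show "\<not> edge_rel G x x" for x
  proof
    assume "edge_rel G x x"
    then have "card {x, x} = 2" using assms unfolding simple_graph_def by blast
    then show False by simp
  qed
  show "edge_rel G x y \<Longrightarrow> x \<in> verts G" for x y using assms unfolding simple_graph_def by blast
qed

lemma twice_card_edges:
  assumes "simple_graph G"
  shows "2 * card (edges G) = fgraph.dn (edge_rel G) (verts G) (verts G)"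
proof -
  interpret fgraph "verts G" "edge_rel G" by (rule fgraph_edge_rel[OF assms])
  have "{(x, y). x \<in> verts G \<and> y \<in> verts G \<and> edge_rel G x y} = {(x, y). {x, y} \<in> edges G}"
    using adj_V adj_V2 by blast
  moreover have "card {(x, y). {x, y} \<in> edges G} = 2 * card (edges G)"
    by (rule card_ordered_pairs[OF finite_edges[OF assms]]) (use assms in \<open>auto simp: simple_graph_def\<close>)
  ultimately show ?thesis using dn_eq_card[OF finite_V] by simp
qed

text \<open>Deleting the edges inside \<open>S\<close> and inside \<open>T\<close> makes the graph
  bipartite.\<close>

lemma gamma2_le:
  assumes G: "simple_graph G" and ST: "S \<inter> T = {}" "S \<union> T = verts G"
  shows "2 * gamma2 G \<le> fgraph.dn (edge_rel G) S S + fgraph.dn (edge_rel G) T T"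
proof -
  interpret fgraph "verts G" "edge_rel G" by (rule fgraph_edge_rel[OF G])
  define D where "D = {e \<in> edges G. e \<subseteq> S \<or> e \<subseteq> T}"
  have D: "D \<subseteq> edges G" by (auto simp: D_def)
  have "bipartite (delete_edges G D)"
    unfolding bipartite_def delete_edges_def
  proof (rule exI[of _ S], rule exI[of _ T], intro conjI ballI)
    fix e assume "e \<in> edges (Graph (verts G) (edges G - D))"
    then have e: "e \<in> edges G" "\<not> e \<subseteq> S" "\<not> e \<subseteq> T" by (auto simp: D_def)
    then have "card e = 2" "e \<subseteq> S \<union> T" using G ST unfolding simple_graph_def by auto
    then obtain x y where "e = {x, y}" by (metis card_2_cases)
    then show "\<exists>a\<in>S. \<exists>b\<in>T. e = {a, b}" using e \<open>e \<subseteq> S \<union> T\<close> by auto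
  qed (use ST in auto)
  then have "card D \<in> {card D | D. D \<subseteq> edges G \<and> bipartite (delete_edges G D)}" using D by blast
  moreover have "finite {card D | D. D \<subseteq> edges G \<and> bipartite (delete_edges G D)}"
    by (rule finite_subset[of _ "card ` Pow (edges G)"]) (auto simp: finite_edges[OF G])
  ultimately have le: "gamma2 G \<le> card D" unfolding gamma2_def by (rule Min_le[rotated])
  have "card e = 2" if "e \<in> D" for e using that D G unfolding simple_graph_def by blast
  then have c2: "card {(x, y). {x, y} \<in> D} = 2 * card D"
    by (rule card_ordered_pairs[OF finite_subset[OF D finite_edges[OF G]]])
  have eq: "{(x, y). {x, y} \<in> D} = {(x, y). x \<in> S \<and> y \<in> S \<and> edge_rel G x y} \<union> {(x, y). x \<in> T \<and> y \<in> T \<and> edge_rel G x y}"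
    by (auto simp: D_def)
  have "card ({(x, y). x \<in> S \<and> y \<in> S \<and> edge_rel G x y} \<union> {(x, y). x \<in> T \<and> y \<in> T \<and> edge_rel G x y}) \<le> dn S S + dn T T"
  proof -
    have "finite S" "finite T" using finite_V unfolding ST(2)[symmetric] by simp_all
    then show ?thesis unfolding dn_eq_card[OF \<open>finite S\<close>] dn_eq_card[OF \<open>finite T\<close>] by (simp only: card_Un_le)
  qed
  then have "2 * card D \<le> dn S S + dn T T" unfolding c2[symmetric] eq .
  then show ?thesis using le by linarith
qed

lemma avoids_cycle_edge_rel:
  assumes "simple_graph G" "cycle_free m G" "3 \<le> m"
  shows "fgraph.avoids_cycle (verts G) (edge_rel G) m"
proof -
  interpret fgraph "verts G" "edge_rel G" by (rule fgraph_edge_rel[OF assms(1)])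
  have False if p: "path p" "length p = m" "edge_rel G (last p) (hd p)" for p
  proof -
    have ne: "p \<noteq> []" using p(2) assms(3) by auto
    have "{p ! i, p ! (Suc i mod length p)} \<in> edges G" if i: "i < length p" for i
    proof (cases "Suc i < length p")
      case True
      then show ?thesis using p(1) unfolding path_def successively_conv_nth by simp
    next
      case False
      then have "Suc i = length p" using i by simp
      then show ?thesis using p(3) ne by (simp add: hd_conv_nth last_conv_nth flip: \<open>Suc i = length p\<close>)
    qed
    then have "is_cycle G p" using p assms(3) by (simp add: is_cycle_def path_def)
    then show False using assms(2) p(2) by (auto simp: cycle_free_def)
  qed
  then show ?thesis unfolding avoids_cycle_def by blast
qed

definition join_edges :: "'a set \<Rightarrow> 'a set \<Rightarrow> 'a set set" where
  "join_edges X Y = {{x, y} | x y. x \<in> X \<and> y \<in> Y}"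

definition clique_edges :: "'a set \<Rightarrow> 'a set set" where
  "clique_edges K = {{x, y} | x y. x \<in> K \<and> y \<in> K \<and> x \<noteq> y}"

text \<open>The common form of \<open>G\<close> and of the graphs in \<open>H_graphs\<close>:
  \<open>u\<close> is the merged vertex and \<open>Z\<close> is the clique without it.\<close>

definition glued :: "'a graph \<Rightarrow> 'a set \<Rightarrow> 'a set \<Rightarrow> 'a set \<Rightarrow> 'a \<Rightarrow> bool" where
  "glued G A B Z u \<longleftrightarrow> finite A \<and> finite B \<and> finite Z \<and> A \<inter> B = {} \<and> (A \<union> B) \<inter> Z = {} \<and> u \<in> A \<union> B
     \<and> verts G = A \<union> B \<union> Z \<and> edges G = join_edges A B \<union> clique_edges (insert u Z)"

lemma image_join_edges: "(`) f ` join_edges X Y = join_edges (f ` X) (f ` Y)"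
  unfolding join_edges_def by (auto simp: image_iff) (metis image_empty image_insert)+

lemma image_clique_edges:
  assumes "inj_on f K"
  shows "(`) f ` clique_edges K = clique_edges (f ` K)"
proof
  show "(`) f ` clique_edges K \<subseteq> clique_edges (f ` K)"
    using assms unfolding clique_edges_def by (auto simp: inj_on_def)
  show "clique_edges (f ` K) \<subseteq> (`) f ` clique_edges K"
  proof
    fix e assume "e \<in> clique_edges (f ` K)"
    then obtain x y where "x \<in> K" "y \<in> K" "x \<noteq> y" "e = f ` {x, y}" unfolding clique_edges_def by auto
    then show "e \<in> (`) f ` clique_edges K" unfolding clique_edges_def by blast
  qed
qed

lemma card_join_edges:
  assumes "finite X" "finite Y" "X \<inter> Y = {}"
  shows "card (join_edges X Y) = card X * card Y"
proof -
  have "join_edges X Y = (\<lambda>(x, y). {x, y}) ` (X \<times> Y)" by (auto simp: join_edges_def)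
  moreover have "inj_on (\<lambda>(x, y). {x, y}) (X \<times> Y)"
    using assms(3) by (auto simp: inj_on_def doubleton_eq_iff)
  ultimately show ?thesis by (simp add: card_image card_cartesian_product)
qed

lemma card_clique_edges:
  assumes "finite K"
  shows "card (clique_edges K) = (card K choose 2)"
proof -
  have "clique_edges K = {e. e \<subseteq> K \<and> card e = 2}"
    by (auto simp: clique_edges_def card_2_iff)
  then show ?thesis using n_subsets[OF assms] by simp
qed

lemma glued_card_edges:
  assumes "glued G A B Z u"
  shows "card (edges G) = card A * card B + (Suc (card Z) choose 2)"
proof -
  have g: "finite A" "finite B" "finite Z" "A \<inter> B = {}" "(A \<union> B) \<inter> Z = {}" "u \<in> A \<union> B"
    "edges G = join_edges A B \<union> clique_edges (insert u Z)" using assms by (auto simp: glued_def)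
  have "u \<notin> Z" using g by blast
  have "join_edges A B \<inter> clique_edges (insert u Z) = {}"
    using g(4,5) by (auto simp: join_edges_def clique_edges_def doubleton_eq_iff)
  moreover have "finite (join_edges A B)"
    by (rule finite_subset[of _ "Pow (A \<union> B)"]) (use g in \<open>auto simp: join_edges_def\<close>)
  moreover have "finite (clique_edges (insert u Z))"
    by (rule finite_subset[of _ "Pow (insert u Z)"]) (use g in \<open>auto simp: clique_edges_def\<close>)
  ultimately show ?thesis
    using g card_join_edges[OF g(1,2,4)] card_clique_edges[of "insert u Z"] \<open>u \<notin> Z\<close>
    by (simp add: card_Un_disjoint)
qed

lemma bij_betw_with_value:
  assumes "finite A" "finite A'" "card A = card A'" "u \<in> A" "u' \<in> A'"
  shows "\<exists>f. bij_betw f A A' \<and> f u = u'"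
proof -
  obtain f where f: "bij_betw f (A - {u}) (A' - {u'})"
    using finite_same_card_bij[of "A - {u}" "A' - {u'}"] assms by auto
  have "bij_betw (f(u := u')) (A - {u}) (A' - {u'})" using f by (rule bij_betw_cong[THEN iffD1, rotated]) auto
  then have "bij_betw (f(u := u')) (insert u (A - {u})) (insert u' (A' - {u'}))"
    using notIn_Un_bij_betw[of u "A - {u}" "f(u := u')" "A' - {u'}"] by simp
  then have "bij_betw (f(u := u')) A A'" using assms by (simp add: insert_absorb)
  then show ?thesis by (intro exI[of _ "f(u := u')"]) simp
qed

lemma glued_iso_first:
  assumes G: "glued G A B Z u" and H: "glued H A' B' Z' u'"
    and card: "card A = card A'" "card B = card B'" "card Z = card Z'" and u: "u \<in> A" "u' \<in> A'"
  shows "graph_iso G H"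
proof -
  have g: "finite A" "finite B" "finite Z" "A \<inter> B = {}" "(A \<union> B) \<inter> Z = {}"
    "verts G = A \<union> B \<union> Z" "edges G = join_edges A B \<union> clique_edges (insert u Z)"
    using G by (auto simp: glued_def)
  have h: "finite A'" "finite B'" "finite Z'" "A' \<inter> B' = {}" "(A' \<union> B') \<inter> Z' = {}"
    "verts H = A' \<union> B' \<union> Z'" "edges H = join_edges A' B' \<union> clique_edges (insert u' Z')"
    using H by (auto simp: glued_def)
  obtain fA fB fZ where f: "bij_betw fA A A'" "fA u = u'" "bij_betw fB B B'" "bij_betw fZ Z Z'"
    using bij_betw_with_value[OF g(1) h(1) card(1) u] finite_same_card_bij[OF g(2) h(2) card(2)]
      finite_same_card_bij[OF g(3) h(3) card(3)] by blast
  define f where "f x = (if x \<in> A then fA x else if x \<in> B then fB x else fZ x)" for x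
  have bA: "bij_betw f A A'" using f(1) by (rule bij_betw_cong[THEN iffD1, rotated]) (simp add: f_def)
  have bB: "bij_betw f B B'"
    using f(3) by (rule bij_betw_cong[THEN iffD1, rotated]) (use g(4) in \<open>auto simp: f_def\<close>)
  have bZ: "bij_betw f Z Z'"
    using f(4) by (rule bij_betw_cong[THEN iffD1, rotated]) (use g(5) in \<open>auto simp: f_def\<close>)
  have bij: "bij_betw f (A \<union> B \<union> Z) (A' \<union> B' \<union> Z')"
    by (rule bij_betw_combine[OF bij_betw_combine[OF bA bB h(4)] bZ h(5)])
  have im: "f ` A = A'" "f ` B = B'" "f ` Z = Z'" using bA bB bZ by (simp_all add: bij_betw_def)
  have fu: "f u = u'" using u f(2) by (simp add: f_def)
  have "inj_on f (insert u Z)"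
    by (rule inj_on_subset[OF bij_betw_imp_inj_on[OF bij]]) (use u in auto)
  then have "edges H = (`) f ` edges G"
    unfolding g(7) h(7) image_Un image_join_edges by (simp add: image_clique_edges im fu)
  then show ?thesis using bij unfolding graph_iso_def g(6) h(6) by blast
qed

lemma join_edges_commute: "join_edges A B = join_edges B A"
  unfolding join_edges_def by (auto simp: insert_commute)

lemma glued_commute: "glued G A B Z u \<Longrightarrow> glued G B A Z u"
  unfolding glued_def by (simp add: join_edges_commute[of A B] Un_commute Int_commute)

text \<open>The classes may differ in size by one, so the position of the merged vertex has to
  match.\<close>

lemma glued_iso:
  assumes "glued G A B Z u" "glued H A' B' Z' u'"
    and "card A = card A'" "card B = card B'" "card Z = card Z'" and "u \<in> A \<longleftrightarrow> u' \<in> A'"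
  shows "graph_iso G H"
proof (cases "u \<in> A")
  case True
  then show ?thesis using glued_iso_first[OF assms(1-5)] assms(6) by simp
next
  case False
  then have "u \<in> B" "u' \<in> B'" using assms by (auto simp: glued_def)
  then show ?thesis
    using glued_iso_first[OF glued_commute[OF assms(1)] glued_commute[OF assms(2)]] assms by simp
qed

lemma glued_H_graph:
  assumes "u < N" "w < m"
  shows "glued (identify_vertices (turan2 N) u (complete_graph m) w)
    (Inl ` {..<N div 2}) (Inl ` {N div 2..<N}) (Inr ` ({..<m} - {w})) (Inl u)"
proof -
  define g where "g x = (if x = w then Inl u else Inr x)" for x :: nat
  have edgesT: "edges (turan2 N) = join_edges {..<N div 2} {N div 2..<N}"
    by (auto simp: turan2_def join_edges_def)
  have edgesK: "edges (complete_graph m) = clique_edges {..<m}"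
  proof -
    have "\<exists>i' j'. {i, j} = {i', j'} \<and> i' < j' \<and> j' < m" if "i < m" "j < m" "i \<noteq> j" for i j :: nat
    proof (cases "i < j")
      case True
      then show ?thesis using that by blast
    next
      case False
      then have "{i, j} = {j, i} \<and> j < i \<and> i < m" using that by auto
      then show ?thesis by blast
    qed
    then have "clique_edges {..<m} \<subseteq> edges (complete_graph m)"
      unfolding complete_graph_def clique_edges_def by auto
    moreover have "edges (complete_graph m) \<subseteq> clique_edges {..<m}"
      unfolding complete_graph_def clique_edges_def graph.sel by fastforce
    ultimately show ?thesis by blast
  qed
  have inj: "inj_on g {..<m}" by (auto simp: inj_on_def g_def split: if_splits)
  have "{..<m} = insert w ({..<m} - {w})" using assms by auto
  then have "g ` {..<m} = insert (g w) (g ` ({..<m} - {w}))" by (metis image_insert)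
  moreover have "g ` ({..<m} - {w}) = Inr ` ({..<m} - {w})" by (auto simp: g_def)
  ultimately have gim: "g ` {..<m} = insert (Inl u) (Inr ` ({..<m} - {w}))" by (simp add: g_def)
  have vT: "verts (turan2 N) = {..<N div 2} \<union> {N div 2..<N}" by (auto simp: turan2_def)
  have vK: "verts (complete_graph m) = {..<m}" by (simp add: complete_graph_def)
  have id: "identify_vertices (turan2 N) u (complete_graph m) w =
      Graph (Inl ` verts (turan2 N) \<union> g ` verts (complete_graph m))
        ((`) Inl ` edges (turan2 N) \<union> (`) g ` edges (complete_graph m))"
    unfolding identify_vertices_def Let_def g_def ..
  show ?thesis
    unfolding glued_def id graph.sel edgesT edgesK image_join_edges image_clique_edges[OF inj] vT vK gim
    using assms by (cases "u < N div 2") auto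
qed

lemma half_times_half: "(N div 2) * (N - N div 2) = N\<^sup>2 div 4" for N :: nat
proof (cases "even N")
  case True
  then obtain j where "N = 2 * j" by blast
  then show ?thesis by (simp add: power2_eq_square algebra_simps)
next
  case False
  then obtain j where "N = 2 * j + 1" by (rule oddE)
  then show ?thesis by (simp add: power2_eq_square algebra_simps)
qed

text \<open>\<open>(t + 3) div 2\<close> is the upper half of \<open>t + 2\<close>, so the left side
  counts the monochromatic edges of a balanced colouring of a clique on \<open>t + 2\<close>
  vertices. The right side is the form in which the greedy bound appears.\<close>

lemma choose_two_halves: "((t + 2) div 2 choose 2) + ((t + 3) div 2 choose 2) = (Suc t)\<^sup>2 div 4"
proof (cases "even t")
  case True
  then obtain j where t: "t = 2 * j" by blast
  have "(Suc t)\<^sup>2 = 4 * (j * j + j) + 1" by (simp add: t power2_eq_square algebra_simps)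
  then have "(Suc t)\<^sup>2 div 4 = j * j + j" by presburger
  then have "2 * (((t + 2) div 2 choose 2) + ((t + 3) div 2 choose 2)) = 2 * ((Suc t)\<^sup>2 div 4)"
    using two_mult_choose_two[of "Suc j"] by (simp add: t)
  then show ?thesis by simp
next
  case False
  then obtain j where t: "t = 2 * j + 1" by (rule oddE)
  then have "2 * (((t + 2) div 2 choose 2) + ((t + 3) div 2 choose 2)) = 2 * ((Suc t)\<^sup>2 div 4)"
    using two_mult_choose_two[of "Suc j"] two_mult_choose_two[of "Suc (Suc j)"]
    by (simp add: power2_eq_square algebra_simps)
  then show ?thesis by simp
qed

lemma card_edges_iso:
  assumes "simple_graph G" "graph_iso G H"
  shows "card (edges G) = card (edges H)"
proof -
  obtain f where f: "bij_betw f (verts G) (verts H)" "edges H = (\<lambda>e. f ` e) ` edges G"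
    using assms(2) unfolding graph_iso_def by blast
  have "inj_on ((`) f) (Pow (verts G))" using f(1) by (simp add: bij_betw_def inj_on_image_Pow)
  then have "inj_on ((`) f) (edges G)"
    by (rule inj_on_subset) (use assms(1) in \<open>auto simp: simple_graph_def\<close>)
  then show ?thesis unfolding f(2) by (simp add: card_image)
qed

theorem theorem1p4:
  fixes n k t :: nat and G :: "'a graph"
  assumes "2 \<le> k"
    and "1 \<le> t" and "t \<le> 2 * k - 2"
    and "252 * t\<^sup>2 * k \<le> n"
    and "simple_graph G"
    and "card (verts G) = n"
    and "cycle_free (2 * k + 1) G"
    and "(((t + 2) div 2) choose 2) + (((t + 3) div 2) choose 2) \<le> gamma2 G"
  shows "card (edges G) \<le> (n - t - 1)\<^sup>2 div 4 + ((t + 2) choose 2) \<and>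
         (card (edges G) = (n - t - 1)\<^sup>2 div 4 + ((t + 2) choose 2)
            \<longleftrightarrow> (\<exists>H\<in>H_graphs n t. graph_iso G H))"
proof -
  interpret fgraph "verts G" "edge_rel G" by (rule fgraph_edge_rel[OF assms(5)])
  have F: "(n - t - 1)\<^sup>2 div 4 + ((t + 2) choose 2) = ext_num n (Suc t)"
    by (simp add: ext_num_def)
  have free: "avoids_cycle (2 * k + 1)"
    using avoids_cycle_edge_rel[OF assms(5,7)] assms(1) by simp
  have cut: "2 * ((Suc t)\<^sup>2 div 4) \<le> dn S S + dn T T" if "S \<inter> T = {}" "S \<union> T = verts G" for S T
    using gamma2_le[OF assms(5) that] assms(8) unfolding choose_two_halves by linarith
  note E = twice_card_edges[OF assms(5)]
  let ?N = "n - Suc t"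
  have extremal: "card (edges G) = ext_num n (Suc t) \<and> (\<exists>H\<in>H_graphs n t. graph_iso G H)"
    if ge: "ext_num n (Suc t) \<le> card (edges G)"
  proof -
    have "2 * ext_num n (Suc t) \<le> dn (verts G) (verts G)" using ge E by linarith
    from extremal_structure[OF assms(1-3,6,4) free cut this]
    obtain A B Z u where eq: "dn (verts G) (verts G) = 2 * ext_num n (Suc t)"
      and V: "verts G = A \<union> B \<union> Z" "A \<inter> B = {}" "(A \<union> B) \<inter> Z = {}"
      and card: "card A = ?N div 2" "card B = ?N - ?N div 2" "card Z = Suc t" and u: "u \<in> A \<union> B"
      and adj: "\<And>x y. edge_rel G x y \<longleftrightarrow>
        x \<in> A \<and> y \<in> B \<or> x \<in> B \<and> y \<in> A \<or> x \<noteq> y \<and> x \<in> insert u Z \<and> y \<in> insert u Z"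
      by blast
    have "e \<in> edges G \<longleftrightarrow> e \<in> join_edges A B \<union> clique_edges (insert u Z)" for e
    proof
      assume e: "e \<in> edges G"
      then have "card e = 2" using assms(5) by (simp add: simple_graph_def)
      then obtain x y where "e = {x, y}" by (metis card_2_cases)
      then show "e \<in> join_edges A B \<union> clique_edges (insert u Z)"
        using adj[of x y] e unfolding join_edges_def clique_edges_def by (auto simp: insert_commute)
    next
      assume "e \<in> join_edges A B \<union> clique_edges (insert u Z)"
      then show "e \<in> edges G" using adj unfolding join_edges_def clique_edges_def by auto
    qed
    then have "edges G = join_edges A B \<union> clique_edges (insert u Z)" by blast
    then have glued: "glued G A B Z u"
      unfolding glued_def using V u finite_V by simp
    \<comment> \<open>The first vertex of the part of \<open>turan2\<close> that corresponds to the
      class of \<open>u\<close>.\<close>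
    define u' where "u' = (if u \<in> A then 0 else ?N div 2)"
    have fin: "finite A" "finite B" using finite_V V(1) by auto
    have u': "u' < ?N" "u \<in> A \<longleftrightarrow> u' < ?N div 2"
    proof -
      have "u \<in> A \<Longrightarrow> 0 < card A" "u \<in> B \<Longrightarrow> 0 < card B" using fin by (auto simp: card_gt_0_iff)
      then show "u' < ?N" "u \<in> A \<longleftrightarrow> u' < ?N div 2" using u card by (auto simp: u'_def)
    qed
    let ?H = "identify_vertices (turan2 ?N) u' (complete_graph (t + 2)) 0"
    have H: "glued ?H (Inl ` {..<?N div 2}) (Inl ` {?N div 2..<?N}) (Inr ` ({..<t + 2} - {0})) (Inl u')"
      by (rule glued_H_graph) (use u' in auto)
    have "graph_iso G ?H"
      by (rule glued_iso[OF glued H]) (use card u' in \<open>auto simp: card_image\<close>)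
    moreover have "?H \<in> H_graphs n t"
      unfolding H_graphs_def using u'(1) by (auto simp: turan2_def complete_graph_def)
    ultimately show ?thesis using eq E by auto
  qed
  have converse: "card (edges G) = ext_num n (Suc t)" if H: "H \<in> H_graphs n t" "graph_iso G H" for H
  proof -
    obtain v w where "H = identify_vertices (turan2 ?N) v (complete_graph (t + 2)) w" "v < ?N" "w < t + 2"
      using H(1) unfolding H_graphs_def by (auto simp: turan2_def complete_graph_def)
    then have "glued H (Inl ` {..<?N div 2}) (Inl ` {?N div 2..<?N}) (Inr ` ({..<t + 2} - {w})) (Inl v)"
      using glued_H_graph by blast
    from glued_card_edges[OF this] \<open>w < t + 2\<close>
    have "card (edges H) = (?N div 2) * (?N - ?N div 2) + (Suc (Suc t) choose 2)"
      by (simp add: card_image)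
    then show ?thesis
      unfolding card_edges_iso[OF assms(5) H(2)] ext_num_def by (simp only: half_times_half)
  qed
  show ?thesis
  proof (cases "ext_num n (Suc t) \<le> card (edges G)")
    case True
    then show ?thesis using extremal unfolding F by simp
  next
    case False
    then show ?thesis using converse unfolding F by force
  qed
qed

end
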